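(* Let $X\in\mathbb{R}^d$ be a random vector with mean $\theta_0$ and covariance matrix $\Sigma_0$, and assume (A1): $\Sigma_0$ is a finite covariance matrix of full rank $d$. Let $X_1,\dots,X_n$ ($n>d$) be independent copies of $X$, $\Theta_n$ the interior of their convex hull, $\tilde\theta$ the sample mean and $l(\theta)$ the empirical log-likelihood ratio for the mean. Let $h_n^C:\Theta_n\to\mathbb{R}^d$, $h_n^C(\theta)=\tilde\theta+\bigl(1+\frac{l(\theta)}{2n}\bigr)(\theta-\tilde\theta)$, be the composite similarity mapping (a bijection onto $\mathbb{R}^d$) with inverse $h_n^{-C}$, and define the extended empirical log-likelihood ratio $l^*(\theta)=l\bigl(h_n^{-C}(\theta)\bigr)$ for $\theta\in\mathbb{R}^d$. Then $$l^*(\theta_0)\xrightarrow{\ \mathcal D\ }\chi^2_d\qquad\text{as }n\to\infty.$$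
   Context: For $\theta\in\mathbb{R}^d$, the empirical likelihood ratio is $R(\theta)=\sup\{\prod_{i=1}^n nw_i : \sum_{i=1}^n w_i(X_i-\theta)=0,\ w_i\ge 0,\ \sum_{i=1}^n w_i=1\}$, and $l(\theta)=-2\log R(\theta)$; $l$ is finite exactly on $\Theta_n$. Standing convention: whenever (A1) is assumed, the convex hull of $X_1,\dots,X_n$ is understood to be nondegenerate (this holds with probability one). *)

theory Defs
  imports "HOL-Probability.Probability"
begin

definition EL_R :: "(nat \<Rightarrow> real^'d) \<Rightarrow> nat \<Rightarrow> real^'d \<Rightarrow> real" where
  "EL_R x n \<theta> = Sup {(\<Prod>i<n. real n * w i) | w :: nat \<Rightarrow> real.
      (\<forall>i<n. 0 \<le> w i) \<and> (\<Sum>i<n. w i) = 1 \<and> (\<Sum>i<n. w i *\<^sub>R (x i - \<theta>)) = 0}"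

definition EL_l :: "(nat \<Rightarrow> real^'d) \<Rightarrow> nat \<Rightarrow> real^'d \<Rightarrow> real" where
  "EL_l x n \<theta> = - 2 * ln (EL_R x n \<theta>)"

definition Theta_n :: "(nat \<Rightarrow> real^'d) \<Rightarrow> nat \<Rightarrow> (real^'d) set" where
  "Theta_n x n = interior (convex hull (x ` {..<n}))"

definition sample_mean :: "(nat \<Rightarrow> real^'d) \<Rightarrow> nat \<Rightarrow> real^'d" where
  "sample_mean x n = (1 / real n) *\<^sub>R (\<Sum>i<n. x i)"

definition hC :: "(nat \<Rightarrow> real^'d) \<Rightarrow> nat \<Rightarrow> real^'d \<Rightarrow> real^'d" where
  "hC x n \<theta> = sample_mean x n + (1 + EL_l x n \<theta> / (2 * real n)) *\<^sub>R (\<theta> - sample_mean x n)"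

definition hC_inv :: "(nat \<Rightarrow> real^'d) \<Rightarrow> nat \<Rightarrow> real^'d \<Rightarrow> real^'d" where
  "hC_inv x n = inv_into (Theta_n x n) (hC x n)"

definition EL_lstar :: "(nat \<Rightarrow> real^'d) \<Rightarrow> nat \<Rightarrow> real^'d \<Rightarrow> real" where
  "EL_lstar x n \<theta> = EL_l x n (hC_inv x n \<theta>)"

definition chi2_density :: "nat \<Rightarrow> real \<Rightarrow> real" where
  "chi2_density k t = (if t > 0 then t powr (real k / 2 - 1) * exp (- t / 2)
        / (2 powr (real k / 2) * Gamma (real k / 2)) else 0)"

definition chi2_distribution :: "nat \<Rightarrow> real measure" where
  "chi2_distribution k = density lborel (\<lambda>t. ennreal (chi2_density k t))"

end

theory Submission
  imports Defs
begin

text \<open>The preimage of \<open>\<theta>0\<close> under the composite similarity mapping lies on the segment from the sample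
  mean to \<open>\<theta>0\<close>, at the position \<open>s = 1 / (1 + l* / (2 n))\<close>. As the likelihood ratio decreases along
  this segment, the event \<open>l* \<le> c\<close> says that the ordinary likelihood ratio is at least \<open>exp (- c / 2)\<close>
  at the explicit point with \<open>s = 1 / (1 + c / (2 n))\<close>; since \<open>s\<close> tends to \<open>1\<close>, Owen's theorem for \<open>\<theta>0\<close>
  carries over. After whitening, a dual bound on the one side and an explicit feasible weight
  vector on the other squeeze \<open>- 2 log R\<close> between multiples of \<open>n |mean|^2\<close> whose factors tend to \<open>1\<close>, on
  events on which the sample covariance is close to the identity and no observation is of order
  \<open>sqrt n\<close>. The statistic \<open>n |mean|^2\<close> is asymptotically chi-square: averaging the one-dimensional central
  limit theorem over Gaussian directions gives the limit of its Laplace transform.\<close>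

section \<open>Sublevel sets of the extended log-likelihood ratio\<close>

text \<open>All arguments run through \<open>EL_feasible\<close>, the existence of weights with
  ratio at least \<open>r\<close>, instead of the supremum \<open>EL_R\<close>, whose value over an
  empty feasible set is unspecified. The predicate is downward closed in \<open>r\<close>, closed
  jointly in sample and point, invariant under injective affine maps, and its logarithmic form is
  concave; the deterministic half rests on these four properties. The sublevel description holds for
  whichever preimage the choice operator in \<open>hC_inv\<close> picks. For fixed \<open>n\<close>
  the hull may be flat with positive probability, so nondegeneracy is derived on the good event,
  where the sample covariance is positive definite. Second moments are all that is given. Products
  of coordinates are then merely integrable, so their law of large numbers goes by truncation, and
  the largest observation is controlled by tail expectations. A tolerance \<open>k\<close> is fixed
  before \<open>n\<close> grows; continuity of the chi-square distribution function absorbs the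
  distortion of the threshold that \<open>k\<close> causes.\<close>

definition EL_feasible :: "(nat \<Rightarrow> real^'d) \<Rightarrow> nat \<Rightarrow> real^'d \<Rightarrow> real \<Rightarrow> bool" where
  "EL_feasible x n \<theta> r \<longleftrightarrow> (\<exists>w::nat \<Rightarrow> real. (\<forall>i<n. 0 \<le> w i) \<and> (\<Sum>i<n. w i) = 1 \<and>
      (\<Sum>i<n. w i *\<^sub>R (x i - \<theta>)) = 0 \<and> r \<le> (\<Prod>i<n. real n * w i))"

text \<open>Coordinates from \<open>n\<close> on are pinned to \<open>0\<close>: otherwise they
  would range freely and the set would not be compact in the product topology.\<close>

definition weight_simplex :: "nat \<Rightarrow> (nat \<Rightarrow> real) set" where
  "weight_simplex n = {w. (\<forall>i. if i < n then w i \<in> {0..1} else w i = 0) \<and> (\<Sum>i<n. w i) = 1}"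

lemma compact_weight_simplex: "compact (weight_simplex n)"
proof -
  let ?B = "\<lambda>i. if i < n then {0..1::real} else {0}"
  have "compactin (product_topology (\<lambda>i. euclidean) UNIV) (PiE UNIV ?B)"
    by (subst compactin_PiE) auto
  then have "compact (PiE UNIV ?B)"
    by (simp add: euclidean_product_topology)
  moreover have "closed {w :: nat \<Rightarrow> real. (\<Sum>i<n. w i) = 1}"
    by (intro closed_Collect_eq continuous_intros continuous_on_product_coordinates)
  ultimately have "compact (PiE UNIV ?B \<inter> {w. (\<Sum>i<n. w i) = 1})"
    by (rule compact_Int_closed)
  also have "PiE UNIV ?B \<inter> {w. (\<Sum>i<n. w i) = 1} = weight_simplex n"
    by (auto simp: weight_simplex_def PiE_iff Ball_def split: if_splits) 
  finally show ?thesis .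
qed

lemma EL_feasible_simplex_iff:
  "EL_feasible x n \<theta> r \<longleftrightarrow> (\<exists>w\<in>weight_simplex n.
      (\<Sum>i<n. w i *\<^sub>R (x i - \<theta>)) = 0 \<and> r \<le> (\<Prod>i<n. real n * w i))"
proof
  assume "EL_feasible x n \<theta> r"
  then obtain w where w: "\<And>i. i < n \<Longrightarrow> 0 \<le> w i" "(\<Sum>i<n. w i) = 1"
    "(\<Sum>i<n. w i *\<^sub>R (x i - \<theta>)) = 0" "r \<le> (\<Prod>i<n. real n * w i)"
    unfolding EL_feasible_def by auto
  have "w i \<le> 1" if "i < n" for i
    using member_le_sum[of i "{..<n}" w] w that by auto
  then have "(\<lambda>i. if i < n then w i else 0) \<in> weight_simplex n"
    using w unfolding weight_simplex_def by auto
  with w show "\<exists>w\<in>weight_simplex n.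
      (\<Sum>i<n. w i *\<^sub>R (x i - \<theta>)) = 0 \<and> r \<le> (\<Prod>i<n. real n * w i)"
    by (intro bexI[of _ "\<lambda>i. if i < n then w i else 0"]) auto
next
  assume "\<exists>w\<in>weight_simplex n.
      (\<Sum>i<n. w i *\<^sub>R (x i - \<theta>)) = 0 \<and> r \<le> (\<Prod>i<n. real n * w i)"
  then obtain w where "w \<in> weight_simplex n" "(\<Sum>i<n. w i *\<^sub>R (x i - \<theta>)) = 0"
    "r \<le> (\<Prod>i<n. real n * w i)" by blast
  moreover from this(1) have "\<forall>i<n. 0 \<le> w i" "(\<Sum>i<n. w i) = 1"
    unfolding weight_simplex_def by (metis (mono_tags, lifting) atLeastAtMost_iff mem_Collect_eq)+
  ultimately show "EL_feasible x n \<theta> r"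
    unfolding EL_feasible_def by blast
qed

text \<open>Projection along a compact factor is a closed map. An existential quantifier over
  weights, or over unit normals, therefore preserves closedness.\<close>

lemma closed_Collect_compact_ex:
  fixes C :: "('a::topological_space \<times> 'b::topological_space) set"
  assumes "compact K" "closed C"
  shows "closed {b. \<exists>a\<in>K. (a, b) \<in> C}"
proof -
  have "compact_space (top_of_set K)"
    using assms(1) by (simp add: compact_space_subtopology)
  then have "closed_map (prod_topology (top_of_set K) euclidean) (euclidean :: 'b topology) snd"
    by (rule closed_map_snd)
  moreover have "closedin (prod_topology (top_of_set K) (euclidean :: 'b topology)) ((K \<times> UNIV) \<inter> C)"
  proof -
    have "prod_topology (top_of_set K) (euclidean :: 'b topology) = top_of_set (K \<times> UNIV)"
      by (metis euclidean_product_topology prod_topology_subtopology(1) subtopology_UNIV prod_topology_subtopology_eu)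
    then show ?thesis
      using assms(2) by (simp add: closedin_closed_Int)
  qed
  ultimately have "closedin euclidean (snd ` ((K \<times> UNIV) \<inter> C))"
    unfolding closed_map_def by blast
  also have "snd ` ((K \<times> UNIV) \<inter> C) = {b. \<exists>a\<in>K. (a, b) \<in> C}"
    by force
  finally show ?thesis by simp
qed

text \<open>The parameter \<open>b\<close> is the whole sample when measurability is at stake, and
  the position on a ray in the construction of a preimage under \<open>hC\<close>.\<close>

lemma closed_EL_feasible:
  fixes X :: "'b::topological_space \<Rightarrow> nat \<Rightarrow> real^'d"
  assumes X: "\<And>i. continuous_on UNIV (\<lambda>b. X b i)" and T: "continuous_on UNIV T"
    and r: "continuous_on UNIV r"
  shows "closed {b. EL_feasible (X b) n (T b) (r b)}"
proof -
  let ?C = "{p :: (nat \<Rightarrow> real) \<times> 'b. (\<Sum>i<n. fst p i *\<^sub>R (X (snd p) i - T (snd p))) = 0} \<inter>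
    {p. r (snd p) \<le> (\<Prod>i<n. real n * fst p i)}"
  have w: "continuous_on UNIV (\<lambda>p :: (nat \<Rightarrow> real) \<times> 'b. fst p i)" for i
    by (rule continuous_on_product_then_coordinatewise) (intro continuous_intros)
  have "continuous_on UNIV (\<lambda>p :: (nat \<Rightarrow> real) \<times> 'b. X (snd p) i)" for i
    using continuous_on_compose2[OF X continuous_on_snd[OF continuous_on_id]] by auto
  moreover have "continuous_on UNIV (\<lambda>p :: (nat \<Rightarrow> real) \<times> 'b. T (snd p))"
    using continuous_on_compose2[OF T continuous_on_snd[OF continuous_on_id]] by auto
  moreover have "continuous_on UNIV (\<lambda>p :: (nat \<Rightarrow> real) \<times> 'b. r (snd p))"
    using continuous_on_compose2[OF r continuous_on_snd[OF continuous_on_id]] by auto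
  ultimately have "closed ?C"
    by (intro closed_Int closed_Collect_eq closed_Collect_le continuous_intros w)
  from closed_Collect_compact_ex[OF compact_weight_simplex this, of n]
  show ?thesis
    by (simp add: EL_feasible_simplex_iff)
qed

lemma EL_feasible_mono: "EL_feasible x n \<theta> r \<Longrightarrow> r' \<le> r \<Longrightarrow> EL_feasible x n \<theta> r'"
  unfolding EL_feasible_def by (meson order_trans)

text \<open>A case of the inequality between arithmetic and geometric mean: each factor
  \<open>t\<close> is at most \<open>exp (t - 1)\<close>, and the exponents sum to
  \<open>0\<close>.\<close>

lemma prod_weights_le_1:
  assumes "\<And>i. i < n \<Longrightarrow> 0 \<le> w i" "(\<Sum>i<n. w i) = (1::real)"
  shows "(\<Prod>i<n. real n * w i) \<le> 1"
proof -
  have "(\<Prod>i<n. real n * w i) \<le> (\<Prod>i<n. exp (real n * w i - 1))"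
    using assms(1) exp_ge_add_one_self[of "real n * w _ - 1"] by (intro prod_mono) auto
  also have "\<dots> = exp (\<Sum>i<n. real n * w i - 1)"
    by (simp add: exp_sum)
  also have "(\<Sum>i<n. real n * w i - 1) = 0"
    using assms(2) by (simp add: sum_subtractf flip: sum_distrib_left)
  finally show ?thesis by simp
qed

lemma EL_feasible_le_1: "EL_feasible x n \<theta> r \<Longrightarrow> r \<le> 1"
  unfolding EL_feasible_def using prod_weights_le_1 by (meson order_trans)

lemma EL_R_eq: "EL_R x n \<theta> = Sup ((\<lambda>w. \<Prod>i<n. real n * w i) `
    {w. (\<forall>i<n. 0 \<le> w i) \<and> (\<Sum>i<n. w i) = 1 \<and> (\<Sum>i<n. w i *\<^sub>R (x i - \<theta>)) = 0})"
  unfolding EL_R_def by (rule arg_cong[of _ _ Sup]) auto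

text \<open>Feasibility at level \<open>0\<close> says that the constraint set is nonempty. A
  maximiser then exists by compactness of the weight simplex, so the equivalence includes the
  boundary case \<open>r = EL_R x n \<theta>\<close>.\<close>

lemma EL_R_attained:
  assumes "EL_feasible x n \<theta> 0"
  shows "EL_feasible x n \<theta> r \<longleftrightarrow> r \<le> EL_R x n \<theta>"
proof
  let ?S = "{w. (\<forall>i<n. 0 \<le> w i) \<and> (\<Sum>i<n. w i) = (1::real) \<and> (\<Sum>i<n. w i *\<^sub>R (x i - \<theta>)) = 0}"
  let ?f = "\<lambda>w. \<Prod>i<n. real n * w i"
  have bdd: "bdd_above (?f ` ?S)"
    by (rule bdd_aboveI2[of _ _ 1]) (auto intro: prod_weights_le_1)
  show "r \<le> EL_R x n \<theta>" if "EL_feasible x n \<theta> r"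
  proof -
    obtain w where "w \<in> ?S" "r \<le> ?f w" using \<open>EL_feasible x n \<theta> r\<close> unfolding EL_feasible_def by auto
    then show ?thesis unfolding EL_R_eq using bdd by (intro cSUP_upper2) auto
  qed
  let ?K = "weight_simplex n \<inter> {w. (\<Sum>i<n. w i *\<^sub>R (x i - \<theta>)) = 0}"
  have "compact ?K"
    by (intro compact_Int_closed compact_weight_simplex closed_Collect_eq continuous_intros
        continuous_on_product_coordinates)
  moreover have "?K \<noteq> {}" using assms unfolding EL_feasible_simplex_iff by auto
  moreover have "continuous_on ?K ?f"
    by (rule continuous_on_subset[of UNIV])
      (intro continuous_intros continuous_on_product_coordinates, simp)
  ultimately obtain w where w: "w \<in> ?K" "\<And>v. v \<in> ?K \<Longrightarrow> ?f v \<le> ?f w"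
    using continuous_attains_sup[of ?K ?f] by auto
  have "EL_R x n \<theta> \<le> ?f w"
    unfolding EL_R_eq
  proof (rule cSUP_least)
    show "?S \<noteq> {}" using assms unfolding EL_feasible_def by auto
    fix v assume v: "v \<in> ?S"
    then have "EL_feasible x n \<theta> (?f v)" unfolding EL_feasible_def by auto
    then show "?f v \<le> ?f w" unfolding EL_feasible_simplex_iff using w(2) by force
  qed
  then show "EL_feasible x n \<theta> r" if "r \<le> EL_R x n \<theta>"
    using w(1) that unfolding EL_feasible_simplex_iff by (intro bexI[of _ w]) auto
qed

section \<open>Concavity of the log-likelihood ratio and geometry of the convex hull\<close>

lemma weighted_sum_eq_0_iff:
  fixes x :: "nat \<Rightarrow> 'v::real_vector" and w :: "nat \<Rightarrow> real"
  assumes "(\<Sum>i<n. w i) = (1::real)"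
  shows "(\<Sum>i<n. w i *\<^sub>R (x i - \<theta>)) = 0 \<longleftrightarrow> (\<Sum>i<n. w i *\<^sub>R x i) = \<theta>"
proof -
  have "(\<Sum>i<n. w i *\<^sub>R (x i - \<theta>)) = (\<Sum>i<n. w i *\<^sub>R x i) - (\<Sum>i<n. w i) *\<^sub>R \<theta>"
    by (simp add: scaleR_diff_right sum_subtractf scaleR_sum_left)
  then show ?thesis using assms by simp
qed

lemma EL_feasible_iff:
  "EL_feasible x n \<theta> r \<longleftrightarrow> (\<exists>w::nat \<Rightarrow> real. (\<forall>i<n. 0 \<le> w i) \<and> (\<Sum>i<n. w i) = 1 \<and>
      (\<Sum>i<n. w i *\<^sub>R x i) = \<theta> \<and> r \<le> (\<Prod>i<n. real n * w i))"
  unfolding EL_feasible_def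
  by (intro ex_cong1 conj_cong refl) (simp add: weighted_sum_eq_0_iff)

lemma EL_feasible_sample_mean:
  assumes "0 < n" shows "EL_feasible x n (sample_mean x n) 1"
  unfolding EL_feasible_iff
  by (rule exI[of _ "\<lambda>_. 1 / real n"])
    (use assms in \<open>auto simp: sample_mean_def scaleR_sum_right\<close>)

lemma exp_le_prod_iff:
  fixes p :: "nat \<Rightarrow> real"
  assumes "\<And>i. i < n \<Longrightarrow> 0 < p i"
  shows "exp a \<le> (\<Prod>i<n. p i) \<longleftrightarrow> a \<le> (\<Sum>i<n. ln (p i))"
proof -
  have "(\<Prod>i<n. p i) = exp (\<Sum>i<n. ln (p i))"
    using assms by (simp add: exp_sum)
  then show ?thesis by simp
qed

text \<open>Mixing the two weight vectors mixes the points, and concavity of \<open>ln\<close> mixes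
  the log-ratios. With the sample mean as one end point, where the log-ratio is \<open>0\<close>,
  this gives monotonicity along rays.\<close>

lemma EL_feasible_convex:
  assumes f1: "EL_feasible x n \<theta>1 (exp a)" and f2: "EL_feasible x n \<theta>2 (exp b)" 
    and u: "0 \<le> u" "u \<le> 1"
  shows "EL_feasible x n ((1 - u) *\<^sub>R \<theta>1 + u *\<^sub>R \<theta>2) (exp ((1 - u) * a + u * b))"
proof -
  obtain v where v: "\<And>i. i < n \<Longrightarrow> 0 \<le> v i" "(\<Sum>i<n. v i) = 1"
    "(\<Sum>i<n. v i *\<^sub>R x i) = \<theta>1" "exp a \<le> (\<Prod>i<n. real n * v i)"
    using f1 unfolding EL_feasible_iff by blast
  obtain w where w: "\<And>i. i < n \<Longrightarrow> 0 \<le> w i" "(\<Sum>i<n. w i) = 1"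
    "(\<Sum>i<n. w i *\<^sub>R x i) = \<theta>2" "exp b \<le> (\<Prod>i<n. real n * w i)"
    using f2 unfolding EL_feasible_iff by blast
  \<comment> \<open>A positive lower bound on the product excludes zero weights, so the logarithms
    below are genuine.\<close>
  have pos: "real n * y i > 0" if "exp c \<le> (\<Prod>i<n. real n * y i)" "i < n" "\<And>i. i < n \<Longrightarrow> 0 \<le> y i"
    for y i and c :: real
  proof -
    have "(\<Prod>i<n. real n * y i) \<noteq> 0" using that(1) exp_gt_zero[of c] by linarith
    then have "y i \<noteq> 0" using that(2) by auto
    then show ?thesis using that(2) that(3)[of i] by (auto simp: less_le)
  qed
  have vpos: "real n * v i > 0" if "i < n" for i using pos[OF v(4) that v(1)] .
  have wpos: "real n * w i > 0" if "i < n" for i using pos[OF w(4) that w(1)] .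
  have ln1: "a \<le> (\<Sum>i<n. ln (real n * v i))"
    using v(4) vpos by (simp add: exp_le_prod_iff)
  have ln2: "b \<le> (\<Sum>i<n. ln (real n * w i))"
    using w(4) wpos by (simp add: exp_le_prod_iff)
  define y where "y i = (1 - u) * v i + u * w i" for i
  have ypos: "real n * y i = (1 - u) * (real n * v i) + u * (real n * w i)" for i
    by (simp add: y_def algebra_simps)
  have y0: "0 \<le> y i" if "i < n" for i
    using v(1)[OF that] w(1)[OF that] u by (simp add: y_def)
  have y1: "0 < real n * y i" if "i < n" for i
    unfolding ypos using vpos[OF that] wpos[OF that] u
    by (cases "u = 0") (auto intro: add_nonneg_pos)
  have "(1 - u) * a + u * b \<le> (1 - u) * (\<Sum>i<n. ln (real n * v i)) + u * (\<Sum>i<n. ln (real n * w i))"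
    using ln1 ln2 u by (intro add_mono mult_left_mono) auto
  also have "\<dots> = (\<Sum>i<n. (1 - u) * ln (real n * v i) + u * ln (real n * w i))"
    by (simp add: sum.distrib sum_distrib_left)
  also have "\<dots> \<le> (\<Sum>i<n. ln (real n * y i))"
  proof (rule sum_mono)
    fix i assume "i \<in> {..<n}"
    then have "i < n" by simp
    show "(1 - u) * ln (real n * v i) + u * ln (real n * w i) \<le> ln (real n * y i)"
      unfolding ypos using concave_onD[OF ln_concave u, of "real n * v i" "real n * w i"]
        vpos[OF \<open>i < n\<close>] wpos[OF \<open>i < n\<close>] by simp
  qed
  finally have "exp ((1 - u) * a + u * b) \<le> (\<Prod>i<n. real n * y i)"
    using y1 by (simp add: exp_le_prod_iff)
  moreover have "(\<Sum>i<n. y i) = 1"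
    unfolding y_def using v(2) w(2) by (simp add: sum.distrib flip: sum_distrib_left)
  moreover have "(\<Sum>i<n. y i *\<^sub>R x i) = (1 - u) *\<^sub>R \<theta>1 + u *\<^sub>R \<theta>2"
    unfolding y_def v(3)[symmetric] w(3)[symmetric]
    by (simp add: scaleR_add_left sum.distrib scaleR_sum_right)
  ultimately show ?thesis
    unfolding EL_feasible_iff using y0 by (intro exI[of _ y]) auto
qed

text \<open>Weights belong to indices and not to points, because the sample may contain
  ties.\<close>

lemma convex_hull_indexed_weights:
  assumes "z \<in> convex hull (x ` {..<n})"
  shows "\<exists>w::nat \<Rightarrow> real. (\<forall>i<n. 0 \<le> w i) \<and> (\<Sum>i<n. w i) = 1 \<and> (\<Sum>i<n. w i *\<^sub>R x i) = z"
    (is "?P z")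
proof -
  have "convex hull (x ` {..<n}) \<subseteq> {z. ?P z}"
  proof (rule hull_minimal)
    show "x ` {..<n} \<subseteq> {z. ?P z}"
    proof clarify
      fix i assume "i < n"
      then show "?P (x i)"
        by (intro exI[of _ "\<lambda>j. if j = i then 1 else 0"]) (auto simp: if_distribR if_distrib cong: if_cong)
    qed
    show "convex {z. ?P z}"
      unfolding convex_alt
    proof (intro ballI allI impI)
      fix a b :: 'a and u :: real
      assume "a \<in> {z. ?P z}" "b \<in> {z. ?P z}" and u: "0 \<le> u \<and> u \<le> 1"
      then obtain v w where v: "\<forall>i<n. 0 \<le> v i" "(\<Sum>i<n. v i) = (1::real)" "(\<Sum>i<n. v i *\<^sub>R x i) = a"
        and w: "\<forall>i<n. 0 \<le> w i" "(\<Sum>i<n. w i) = (1::real)" "(\<Sum>i<n. w i *\<^sub>R x i) = b" by auto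
      then have "(\<Sum>i<n. ((1-u) * v i + u * w i) *\<^sub>R x i) = (1 - u) *\<^sub>R a + u *\<^sub>R b"
        by (auto simp: scaleR_add_left sum.distrib scaleR_sum_right)
      moreover have "(\<Sum>i<n. (1-u) * v i + u * w i) = 1"
        using v w by (simp add: sum.distrib flip: sum_distrib_left)
      ultimately show "(1 - u) *\<^sub>R a + u *\<^sub>R b \<in> {z. ?P z}"
        using u v w by (intro CollectI exI[of _ "\<lambda>i. (1-u) * v i + u * w i"]) auto
    qed
  qed
  with assms show ?thesis by auto
qed

text \<open>A convex set has empty interior iff it lies in a hyperplane. The normal is taken of unit
  length so that it ranges over a compact set.\<close>

lemma Theta_n_empty_iff:
  assumes "0 < n"
  shows "Theta_n x n = {} \<longleftrightarrow> (\<exists>a. norm a = 1 \<and> (\<forall>i<n. a \<bullet> x i = a \<bullet> x 0))"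
proof
  assume "Theta_n x n = {}"
  then obtain a b where ab: "a \<noteq> 0" "convex hull (x ` {..<n}) \<subseteq> {x. a \<bullet> x = b}"
    unfolding Theta_n_def by (metis convex_convex_hull empty_interior_subset_hyperplane)
  have "a \<bullet> x i = b" if "i < n" for i
    using ab(2) hull_inc[of "x i" "x ` {..<n}" convex] that by auto
  then show "\<exists>a. norm a = 1 \<and> (\<forall>i<n. a \<bullet> x i = a \<bullet> x 0)"
    using assms ab(1) by (intro exI[of _ "a /\<^sub>R norm a"]) auto
next
  assume "\<exists>a. norm a = 1 \<and> (\<forall>i<n. a \<bullet> x i = a \<bullet> x 0)"
  then obtain a where a: "norm a = 1" "\<And>i. i < n \<Longrightarrow> a \<bullet> x i = a \<bullet> x 0" by auto
  have "convex hull (x ` {..<n}) \<subseteq> {y. a \<bullet> y = a \<bullet> x 0}"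
    using a(2) by (intro hull_minimal convex_hyperplane) auto
  then have "interior (convex hull (x ` {..<n})) \<subseteq> interior {y. a \<bullet> y = a \<bullet> x 0}"
    by (rule interior_mono)
  also have "interior {y. a \<bullet> y = a \<bullet> x 0} = {}"
    using a(1) by (intro interior_hyperplane) auto
  finally show "Theta_n x n = {}" by (simp add: Theta_n_def)
qed

text \<open>Interior points admit strictly positive weights: move a little beyond
  \<open>\<theta>\<close>, away from the sample mean, while staying in the hull, and mix the weights
  found there with the uniform ones to return to \<open>\<theta>\<close>.\<close>

lemma Theta_n_feasible:
  assumes "\<theta> \<in> Theta_n x n"
  shows "\<exists>a. EL_feasible x n \<theta> (exp a)"
proof -
  have n: "0 < n" using assms by (cases n) (auto simp: Theta_n_def)
  let ?m = "sample_mean x n"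
  obtain e where e: "e > 0" "ball \<theta> e \<subseteq> convex hull (x ` {..<n})"
    using assms unfolding Theta_n_def mem_interior by auto
  \<comment> \<open>The overshoot has length below \<open>e / 2\<close>; the added \<open>1\<close>
    avoids division by zero when \<open>\<theta>\<close> is the mean.\<close>
  define d where "d = e / (2 * (norm (\<theta> - ?m) + 1))"
  have np: "norm (\<theta> - ?m) + 1 > 0" by (smt (verit) norm_ge_zero)
  have d: "d > 0" using e np by (simp add: d_def)
  have "d * norm (\<theta> - ?m) \<le> d * (norm (\<theta> - ?m) + 1)" using d by (intro mult_left_mono) auto
  also have "\<dots> = e / 2" using np by (simp add: d_def field_simps)
  finally have "d * norm (\<theta> - ?m) < e" using e by simp
  then have "\<theta> + d *\<^sub>R (\<theta> - ?m) \<in> ball \<theta> e"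
    using d by (simp add: dist_norm)
  with e(2) obtain w where w: "\<And>i. i < n \<Longrightarrow> 0 \<le> w i" "(\<Sum>i<n. w i) = 1"
    "(\<Sum>i<n. w i *\<^sub>R x i) = \<theta> + d *\<^sub>R (\<theta> - ?m)"
    using convex_hull_indexed_weights by blast
  \<comment> \<open>The mixing proportions \<open>1 / (1 + d)\<close> and \<open>d / (1 + d)\<close>
    undo the overshoot, and the uniform part makes each weight positive.\<close>
  define y where "y i = (w i + d / real n) / (1 + d)" for i
  have y0: "0 < y i" if "i < n" for i
    using w(1)[OF that] d n by (auto simp: y_def intro!: divide_pos_pos add_nonneg_pos)
  have y1: "(\<Sum>i<n. y i) = 1"
    using w(2) d n by (simp add: y_def sum.distrib flip: sum_divide_distrib)
  have "(\<Sum>i<n. y i *\<^sub>R x i) = (1 / (1 + d)) *\<^sub>R (\<Sum>i<n. w i *\<^sub>R x i + (d / real n) *\<^sub>R x i)"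
    by (simp add: y_def scaleR_sum_right scaleR_add_left add_divide_distrib scaleR_add_right mult.commute)
  also have "(\<Sum>i<n. w i *\<^sub>R x i + (d / real n) *\<^sub>R x i) = \<theta> + d *\<^sub>R (\<theta> - ?m) + d *\<^sub>R ?m"
    using w(3) by (simp add: sum.distrib sample_mean_def scaleR_sum_right)
  also have "\<dots> = (1 + d) *\<^sub>R \<theta>" by (simp add: algebra_simps)
  finally have "(\<Sum>i<n. y i *\<^sub>R x i) = \<theta>" using d by simp
  moreover have "exp (\<Sum>i<n. ln (real n * y i)) \<le> (\<Prod>i<n. real n * y i)"
    using y0 n by (subst exp_le_prod_iff) auto
  ultimately show ?thesis
    using y0 y1 unfolding EL_feasible_iff by (intro exI[of _ "\<Sum>i<n. ln (real n * y i)"] exI[of _ y]) (auto intro: less_imp_le)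
qed

text \<open>If \<open>\<theta>\<close> were not interior, a hyperplane through it would support the
  hull. All weights are positive and balance at \<open>\<theta>\<close>, which forces every
  observation onto the hyperplane, against nondegeneracy.\<close>

lemma feasible_Theta_n:
  assumes ne: "Theta_n x n \<noteq> {}" and f: "EL_feasible x n \<theta> (exp a)"
  shows "\<theta> \<in> Theta_n x n"
proof (rule ccontr)
  assume "\<theta> \<notin> Theta_n x n"
  let ?H = "convex hull (x ` {..<n})"
  have "convex (Theta_n x n)" by (simp add: Theta_n_def convex_interior)
  with \<open>\<theta> \<notin> Theta_n x n\<close> ne obtain p b where p: "p \<noteq> 0" "p \<bullet> \<theta> \<le> b" "\<And>y. y \<in> Theta_n x n \<Longrightarrow> b \<le> p \<bullet> y"
    using separating_hyperplane_sets[of "{\<theta>}" "Theta_n x n"] by auto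
  have "closure (Theta_n x n) \<subseteq> {y. b \<le> p \<bullet> y}"
    using p(3) by (intro closure_minimal closed_halfspace_ge) auto
  moreover have "?H \<subseteq> closure (Theta_n x n)"
    using ne unfolding Theta_n_def by (simp add: convex_closure_interior closure_subset)
  ultimately have H: "b \<le> p \<bullet> y" if "y \<in> ?H" for y using that by auto
  have ge: "0 \<le> p \<bullet> x i - p \<bullet> \<theta>" if "i < n" for i
    using H[of "x i"] p(2) that by (auto simp: hull_inc)
  obtain w where w: "\<And>i. i < n \<Longrightarrow> 0 \<le> w i" "(\<Sum>i<n. w i) = 1"
    "(\<Sum>i<n. w i *\<^sub>R (x i - \<theta>)) = 0" "exp a \<le> (\<Prod>i<n. real n * w i)"
    using f unfolding EL_feasible_def by auto
  have "(\<Prod>i<n. real n * w i) \<noteq> 0" using w(4) exp_gt_zero[of a] by linarith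
  then have wnz: "w i \<noteq> 0" if "i < n" for i using that by auto
  have "(\<Sum>i<n. w i * (p \<bullet> x i - p \<bullet> \<theta>)) = p \<bullet> (\<Sum>i<n. w i *\<^sub>R (x i - \<theta>))"
    by (simp add: inner_sum_right inner_diff_right)
  also have "\<dots> = 0" by (simp add: w(3))
  finally have "\<forall>i\<in>{..<n}. w i * (p \<bullet> x i - p \<bullet> \<theta>) = 0"
    using ge w(1) by (subst (asm) sum_nonneg_eq_0_iff) auto
  then have eq: "p \<bullet> x i = p \<bullet> \<theta>" if "i < n" for i using wnz[OF that] that by auto
  have n: "0 < n" using w(2) by (cases n) auto
  have "Theta_n x n = {}"
    unfolding Theta_n_empty_iff[OF n] using eq n p(1) by (intro exI[of _ "p /\<^sub>R norm p"]) auto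
  with ne show False by simp
qed

lemma EL_feasible_exp_iff:
  assumes "\<theta> \<in> Theta_n x n"
  shows "EL_feasible x n \<theta> (exp a) \<longleftrightarrow> EL_l x n \<theta> \<le> - 2 * a"
proof -
  obtain b where b: "EL_feasible x n \<theta> (exp b)" using Theta_n_feasible[OF assms] ..
  then have 0: "EL_feasible x n \<theta> 0" by (rule EL_feasible_mono) simp
  have pos: "EL_R x n \<theta> > 0"
    using b unfolding EL_R_attained[OF 0] by (meson exp_gt_zero less_le_trans)
  show ?thesis
    unfolding EL_R_attained[OF 0] EL_l_def using pos by (simp add: ln_ge_iff)
qed

lemma EL_l_nonneg:
  assumes "\<theta> \<in> Theta_n x n" shows "0 \<le> EL_l x n \<theta>"
proof -
  have "EL_feasible x n \<theta> (exp (- EL_l x n \<theta> / 2))"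
    unfolding EL_feasible_exp_iff[OF assms] by simp
  from EL_feasible_le_1[OF this] show ?thesis by simp
qed

text \<open>This is the source of continuity: a finite convex function on an open set is
  continuous.\<close>

lemma convex_on_EL_l: "convex_on (Theta_n x n) (EL_l x n)"
proof (rule convex_onI)
  fix t :: real and \<theta>1 \<theta>2 assume t: "0 < t" "t < 1" and th: "\<theta>1 \<in> Theta_n x n" "\<theta>2 \<in> Theta_n x n"
  have "convex (Theta_n x n)" by (simp add: Theta_n_def convex_interior)
  then have mem: "(1 - t) *\<^sub>R \<theta>1 + t *\<^sub>R \<theta>2 \<in> Theta_n x n"
    using t th unfolding convex_alt by auto
  have "EL_feasible x n ((1 - t) *\<^sub>R \<theta>1 + t *\<^sub>R \<theta>2)
      (exp ((1 - t) * (- EL_l x n \<theta>1 / 2) + t * (- EL_l x n \<theta>2 / 2)))"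
    using t th by (intro EL_feasible_convex) (auto simp: EL_feasible_exp_iff)
  then show "EL_l x n ((1 - t) *\<^sub>R \<theta>1 + t *\<^sub>R \<theta>2) \<le> (1 - t) * EL_l x n \<theta>1 + t * EL_l x n \<theta>2"
    unfolding EL_feasible_exp_iff[OF mem] by (simp add: field_simps)
qed (simp add: Theta_n_def convex_interior)

text \<open>On the ray from the sample mean through \<open>\<theta>\<close>, the point \<open>s\<close> solves \<open>hC = \<theta>\<close> iff
  \<open>EL_l = 2 n (1 / s - 1)\<close>; the largest \<open>s\<close> at which the likelihood ratio is at least
  \<open>exp (- n (1 / s - 1))\<close> is a solution, since \<open>EL_l\<close> is continuous on the interior of the hull.\<close>

lemma hC_surj:
  assumes ne: "Theta_n x n \<noteq> {}"
  shows "\<theta> \<in> hC x n ` Theta_n x n"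
proof -
  have n: "0 < n" using ne by (cases n) (auto simp: Theta_n_def)
  define m where "m = sample_mean x n"
  define p where "p s = m + s *\<^sub>R (\<theta> - m)" for s
  define e where "e s = - real n * (1 / s - 1)" for s
  have fm: "EL_feasible x n m (exp 0)" using EL_feasible_sample_mean[OF n] by (simp add: m_def)
  have mT: "m \<in> Theta_n x n" using feasible_Theta_n[OF ne fm] .
  have openT: "open (Theta_n x n)" by (simp add: Theta_n_def)
  have contp: "continuous_on S p" for S unfolding p_def by (intro continuous_intros)
  have "open (p -` Theta_n x n)"
    using openT contp by (intro open_vimage) auto
  moreover have "0 \<in> p -` Theta_n x n" using mT by (simp add: p_def)
  ultimately obtain d where d: "d > 0" "ball 0 d \<subseteq> p -` Theta_n x n"
    by (meson openE)
  define t where "t = min 1 (d / 2)"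
  have t: "0 < t" "t \<le> 1" "p t \<in> Theta_n x n"
    using d by (auto simp: t_def subset_eq dist_norm)
  obtain b where b: "EL_feasible x n (p t) (exp b)" using Theta_n_feasible[OF t(3)] ..
  have b0: "b \<le> 0" using EL_feasible_le_1[OF b] by simp
  \<comment> \<open>At \<open>s = 1 / (1 - b / real n)\<close> the level \<open>e s\<close> equals
    \<open>b\<close>, and it falls as \<open>s\<close> decreases. To the left of both this value and
    \<open>t\<close>, the level guaranteed by concavity is therefore at least
    \<open>e s\<close>.\<close>
  define s0 where "s0 = min t (1 / (1 - b / real n))"
  have q: "1 - b / real n \<ge> 1" using b0 n by (simp add: divide_nonpos_pos)
  have s0: "0 < s0" "s0 \<le> 1" "s0 \<le> t" using t q by (auto simp: s0_def)
  have fs0: "EL_feasible x n (p s0) (exp (e s0))"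
  proof -
    have "EL_feasible x n ((1 - s0 / t) *\<^sub>R m + (s0 / t) *\<^sub>R p t) (exp ((1 - s0 / t) * 0 + (s0 / t) * b))"
      using s0 t by (intro EL_feasible_convex fm b) auto
    moreover have "(1 - s0 / t) *\<^sub>R m + (s0 / t) *\<^sub>R p t = p s0"
      using t by (simp add: p_def algebra_simps)
    moreover have "e s0 \<le> (1 - s0 / t) * 0 + (s0 / t) * b"
    proof -
      have "s0 \<le> 1 / (1 - b / real n)" by (simp add: s0_def)
      then have "1 - b / real n \<le> 1 / s0" using s0 q by (simp add: field_simps)
      then have "real n * (1 - b / real n) \<le> real n * (1 / s0)" by (intro mult_left_mono) auto
      then have "e s0 \<le> b" using n by (simp add: e_def algebra_simps)
      also have "b \<le> (s0 / t) * b" using mult_right_mono_neg[of "s0 / t" 1 b] b0 s0 t by simp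
      finally show ?thesis by simp
    qed
    ultimately show ?thesis by (auto intro: EL_feasible_mono)
  qed
  define A where "A = {s\<in>{s0..1}. EL_feasible x n (p s) (exp (e s))}"
  \<comment> \<open>Clamping with \<open>max s0\<close> makes \<open>e\<close> continuous on the
    whole line and changes nothing on \<open>{s0..1}\<close>.\<close>
  have "closed {s. EL_feasible x n (p (max s0 s)) (exp (e (max s0 s)))}"
  proof (rule closed_EL_feasible)
    show "continuous_on UNIV (\<lambda>s. p (max s0 s))" unfolding p_def by (intro continuous_intros)
    have "max s0 s \<noteq> 0" for s using s0 by linarith
    then show "continuous_on UNIV (\<lambda>s. exp (e (max s0 s)))"
      unfolding e_def by (intro continuous_intros) auto
  qed simp
  then have "closed ({s0..1} \<inter> {s. EL_feasible x n (p (max s0 s)) (exp (e (max s0 s)))})"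
    by (intro closed_Int) auto
  also have "{s0..1} \<inter> {s. EL_feasible x n (p (max s0 s)) (exp (e (max s0 s)))} = A"
    by (auto simp: A_def max_def)
  finally have "closed A" .
  moreover have "s0 \<in> A" using fs0 s0 by (simp add: A_def)
  moreover have bddA: "bdd_above A" by (rule bdd_aboveI[of _ 1]) (auto simp: A_def)
  ultimately have SA: "Sup A \<in> A" by (intro closed_contains_Sup) auto
  define s where "s = Sup A"
  have s: "s0 \<le> s" "s \<le> 1" "EL_feasible x n (p s) (exp (e s))"
    using SA by (auto simp: A_def s_def)
  have sT: "p s \<in> Theta_n x n" using feasible_Theta_n[OF ne s(3)] .
  have le: "EL_l x n (p s) \<le> 2 * real n * (1 / s - 1)"
    using s(3) unfolding EL_feasible_exp_iff[OF sT] e_def by simp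
  have "EL_l x n (p s) = 2 * real n * (1 / s - 1)"
  proof (rule ccontr)
    assume "EL_l x n (p s) \<noteq> 2 * real n * (1 / s - 1)"
    with le have lt: "EL_l x n (p s) < 2 * real n * (1 / s - 1)" by simp
    \<comment> \<open>At \<open>s = 1\<close> the right-hand side is \<open>0\<close>, below which
      \<open>EL_l\<close> cannot fall. Hence there is room to the right of \<open>s\<close>, and
      continuity produces a larger element of \<open>A\<close>.\<close>
    have "s \<noteq> 1" using lt EL_l_nonneg[OF sT] by auto
    with s have s1: "s < 1" by simp
    have "isCont (EL_l x n) (p s)"
      using convex_on_continuous[OF openT convex_on_EL_l] sT openT by (simp add: continuous_on_eq_continuous_at)
    moreover have pc: "isCont p s" using contp[of UNIV] by (simp add: continuous_on_eq_continuous_at)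
    ultimately have "isCont (\<lambda>u. EL_l x n (p u)) s" by (rule isCont_o2[rotated])
    moreover have "isCont (\<lambda>u. 2 * real n * (1 / u - 1)) s"
      using s s0 by (intro continuous_intros) auto
    ultimately have "isCont (\<lambda>u. 2 * real n * (1 / u - 1) - EL_l x n (p u)) s"
      by (rule isCont_diff[rotated])
    then have "eventually (\<lambda>u. 0 < 2 * real n * (1 / u - 1) - EL_l x n (p u)) (at s)"
      using lt by (intro order_tendstoD(1)[of _ "2 * real n * (1 / s - 1) - EL_l x n (p s)"]) (auto simp: isCont_def)
    moreover have "eventually (\<lambda>u. p u \<in> Theta_n x n) (at s)"
      using pc sT openT by (auto simp: isCont_def intro: topological_tendstoD)
    ultimately have "eventually (\<lambda>u. 0 < 2 * real n * (1 / u - 1) - EL_l x n (p u) \<and> p u \<in> Theta_n x n) (at_right s)"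
      by (auto simp: eventually_conj_iff eventually_at_split)
    moreover have "eventually (\<lambda>u. s < u \<and> u < 1) (at_right s)"
      using s1 eventually_at_right_less[of s] by (auto simp: eventually_conj_iff eventually_at_right)
    ultimately have "eventually (\<lambda>u. u \<in> A \<and> s < u) (at_right s)"
    proof eventually_elim
      case (elim u)
      then have "EL_feasible x n (p u) (exp (e u))"
        by (subst EL_feasible_exp_iff) (auto simp: e_def)
      with elim s show ?case by (simp add: A_def)
    qed
    then have "\<exists>u. u \<in> A \<and> s < u"
      using eventually_happens[of _ "at_right s"] trivial_limit_at_right_real[of s] by blast
    with cSup_upper[OF _ bddA] show False by (force simp: s_def)
  qed
  then have "hC x n (p s) = m + (1 + (1 / s - 1)) *\<^sub>R (s *\<^sub>R (\<theta> - m))"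
    using n by (simp add: hC_def p_def flip: m_def)
  also have "\<dots> = \<theta>" using s s0 by simp
  finally show ?thesis using sT by force
qed

text \<open>Since \<open>EL_lstar\<close> depends on the position \<open>s\<close> of the preimage on the ray through
  \<open>s = 1 / (1 + EL_lstar / (2 n))\<close>, its sublevel sets are superlevel sets of the likelihood ratio
  at an explicit point.\<close>

lemma EL_lstar_le_iff:
  assumes ne: "Theta_n x n \<noteq> {}" and c: "0 \<le> c"
  shows "EL_lstar x n \<theta> \<le> c \<longleftrightarrow> EL_feasible x n
    (sample_mean x n + (1 / (1 + c / (2 * real n))) *\<^sub>R (\<theta> - sample_mean x n)) (exp (- c / 2))"
proof -
  have n: "0 < n" using ne by (cases n) (auto simp: Theta_n_def)
  define m where "m = sample_mean x n"
  define q where "q = hC_inv x n \<theta>"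
  define L where "L = EL_l x n q"
  have qT: "q \<in> Theta_n x n"
    unfolding q_def hC_inv_def using hC_surj[OF ne] by (rule inv_into_into)
  have hq: "hC x n q = \<theta>"
    unfolding q_def hC_inv_def using hC_surj[OF ne] by (rule f_inv_into_f)
  have L0: "0 \<le> L" unfolding L_def using EL_l_nonneg[OF qT] .
  define sL where "sL = 1 / (1 + L / (2 * real n))"
  define sc where "sc = 1 / (1 + c / (2 * real n))"
  have pos: "1 + L / (2 * real n) > 0" "1 + c / (2 * real n) > 0"
    using n L0 c by (auto intro: add_pos_nonneg)
  have "\<theta> - m = (1 + L / (2 * real n)) *\<^sub>R (q - m)"
    using hq by (simp add: hC_def m_def L_def algebra_simps)
  then have q: "q = m + sL *\<^sub>R (\<theta> - m)" using pos by (simp add: sL_def)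
  have sL: "0 < sL" "sL \<le> 1" and sc: "0 < sc" "sc \<le> 1" using pos n L0 c by (auto simp: sL_def sc_def)
  have s_le: "sc \<le> sL \<longleftrightarrow> L \<le> c"
    using pos n by (simp add: sL_def sc_def frac_le_eq divide_simps mult.commute)
  have fm: "EL_feasible x n m (exp 0)" using EL_feasible_sample_mean[OF n] by (simp add: m_def)
  have fq: "EL_feasible x n q (exp a) \<longleftrightarrow> L \<le> - 2 * a" for a
    unfolding L_def using EL_feasible_exp_iff[OF qT] .
  have "L \<le> c \<longleftrightarrow> EL_feasible x n (m + sc *\<^sub>R (\<theta> - m)) (exp (- c / 2))"
  proof
    assume Lc: "L \<le> c"
    \<comment> \<open>Here the explicit point lies between the mean and the preimage
      \<open>q\<close>; in the converse direction \<open>q\<close> lies between the mean and that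
      point.\<close>
    have "EL_feasible x n ((1 - sc / sL) *\<^sub>R m + (sc / sL) *\<^sub>R q)
        (exp ((1 - sc / sL) * 0 + (sc / sL) * (- L / 2)))"
      using s_le Lc sL sc by (intro EL_feasible_convex fm) (auto simp: fq)
    moreover have "(1 - sc / sL) *\<^sub>R m + (sc / sL) *\<^sub>R q = m + sc *\<^sub>R (\<theta> - m)"
      using sL by (simp add: q algebra_simps)
    moreover have "- c / 2 \<le> (1 - sc / sL) * 0 + (sc / sL) * (- L / 2)"
    proof -
      have "sc / sL * L \<le> 1 * L" using s_le Lc sL L0 by (intro mult_right_mono) auto
      then show ?thesis using Lc by simp
    qed
    ultimately show "EL_feasible x n (m + sc *\<^sub>R (\<theta> - m)) (exp (- c / 2))"
      by (auto intro: EL_feasible_mono)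
  next
    assume f: "EL_feasible x n (m + sc *\<^sub>R (\<theta> - m)) (exp (- c / 2))"
    show "L \<le> c"
    proof (rule ccontr)
      assume "\<not> L \<le> c"
      then have lt: "sL \<le> sc" "c < L" using s_le by auto
      have "EL_feasible x n ((1 - sL / sc) *\<^sub>R m + (sL / sc) *\<^sub>R (m + sc *\<^sub>R (\<theta> - m)))
        (exp ((1 - sL / sc) * 0 + (sL / sc) * (- c / 2)))"
        using lt sL sc by (intro EL_feasible_convex fm f) auto
      moreover have "(1 - sL / sc) *\<^sub>R m + (sL / sc) *\<^sub>R (m + sc *\<^sub>R (\<theta> - m)) = q"
        using sc by (simp add: q algebra_simps)
      ultimately have "L \<le> sL / sc * c" by (simp add: fq)
      also have "\<dots> \<le> 1 * c" using lt sc c by (intro mult_right_mono) auto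
      finally show False using lt by simp
    qed
  qed
  then show ?thesis
    by (simp add: EL_lstar_def L_def q_def m_def sc_def)
qed

lemma EL_lstar_nonneg:
  assumes "Theta_n x n \<noteq> {}" shows "0 \<le> EL_lstar x n \<theta>"
  unfolding EL_lstar_def hC_inv_def using inv_into_into[OF hC_surj[OF assms]] by (rule EL_l_nonneg)

section \<open>Measurability in the sample\<close>

lemma closed_degenerate:
  fixes n :: nat
  assumes "0 < n"
  shows "closed {x :: nat \<Rightarrow> real^'d. Theta_n x n = {}}"
proof -
  let ?C = "\<Inter>i<n. {p :: (real^'d) \<times> (nat \<Rightarrow> real^'d). fst p \<bullet> snd p i = fst p \<bullet> snd p 0}"
  have x: "continuous_on UNIV (\<lambda>p :: (real^'d) \<times> (nat \<Rightarrow> real^'d). snd p i)" for i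
    by (rule continuous_on_product_then_coordinatewise) (intro continuous_intros)
  have "closed ?C"
    by (intro closed_INT ballI closed_Collect_eq continuous_intros x)
  from closed_Collect_compact_ex[OF compact_sphere[of "0 :: real^'d" 1] this]
  show ?thesis by (simp add: Theta_n_empty_iff[OF assms] Bex_def) (simp add: Ball_def)
qed

text \<open>At an infeasible point \<open>EL_R\<close> is the unspecified constant
  \<open>Sup {}\<close>. Separating this case keeps the superlevel sets measurable whatever that
  constant is.\<close>

lemma EL_R_ge_iff:
  "r \<le> EL_R x n \<theta> \<longleftrightarrow> EL_feasible x n \<theta> r \<or> (\<not> EL_feasible x n \<theta> 0 \<and> r \<le> Sup {})"
proof (cases "EL_feasible x n \<theta> 0")
  case True then show ?thesis using EL_R_attained by auto
next
  case False
  have none: "\<not> EL_feasible x n \<theta> r'" for r'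
  proof
    assume "EL_feasible x n \<theta> r'"
    then obtain w where w: "\<forall>i<n. 0 \<le> w i" "(\<Sum>i<n. w i) = 1" "(\<Sum>i<n. w i *\<^sub>R (x i - \<theta>)) = 0"
      unfolding EL_feasible_def by auto
    then have "0 \<le> (\<Prod>i<n. real n * w i)" by (intro prod_nonneg) auto
    with w False show False unfolding EL_feasible_def by blast
  qed
  then have "EL_R x n \<theta> = Sup {}"
    unfolding EL_R_def by (intro arg_cong[of _ _ Sup]) (auto simp: EL_feasible_def)
  with False none show ?thesis by auto
qed

text \<open>The degenerate samples form a closed set, on which \<open>hC_inv\<close> is constant.
  Off this set each sublevel set is a feasibility condition that is closed in the sample, or
  empty.\<close>

lemma measurable_EL_lstar:
  fixes X :: "nat \<Rightarrow> 'a \<Rightarrow> real^'d"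
  assumes n: "0 < n" and X: "\<And>i. X i \<in> borel_measurable M"
  shows "(\<lambda>\<omega>. EL_lstar (\<lambda>i. X i \<omega>) n \<theta>) \<in> borel_measurable M"
proof -
  have Xm: "(\<lambda>\<omega> i. X i \<omega>) \<in> borel_measurable M"
    using X by (rule measurable_coordinatewise_then_product)
  have feas: "{x. EL_feasible x n (T x) r} \<in> sets borel" if "continuous_on UNIV T" for T :: "(nat \<Rightarrow> real^'d) \<Rightarrow> _" and r
    using that by (intro borel_closed closed_EL_feasible) auto
  have deg: "{x :: nat \<Rightarrow> real^'d. Theta_n x n = {}} \<in> sets borel"
    using n by (intro borel_closed closed_degenerate)
  \<comment> \<open>the junk value of \<open>hC_inv\<close> when the hull is degenerate; the event of degeneracy may have
    positive probability for finite \<open>n\<close>, so measurability must be shown there as well\<close>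
  define q :: "real^'d" where "q = (SOME y. y \<in> {} \<and> hC undefined n y = \<theta>)"
  have R: "(\<lambda>x. EL_R x n q) \<in> borel_measurable borel"
    unfolding borel_measurable_iff_ge
  proof
    fix r
    have "{x. EL_feasible x n q r} \<union> ({x. \<not> EL_feasible x n q 0} \<inter> {x. r \<le> Sup {}}) \<in> sets borel"
      using feas[of "\<lambda>_. q" r] feas[of "\<lambda>_. q" 0] by (auto simp: Collect_neg_eq)
    also have "{x. EL_feasible x n q r} \<union> ({x. \<not> EL_feasible x n q 0} \<inter> {x. r \<le> Sup {}}) = {x. r \<le> EL_R x n q}"
      by (auto simp: EL_R_ge_iff)
    finally show "{w \<in> space borel. r \<le> EL_R w n q} \<in> sets borel" by simp
  qed
  have qeq: "hC_inv x n \<theta> = q" if "Theta_n x n = {}" for x :: "nat \<Rightarrow> real^'d"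
    using that by (simp add: hC_inv_def q_def inv_into_def)
  have "(\<lambda>x. EL_lstar x n \<theta>) \<in> borel_measurable borel"
    unfolding borel_measurable_iff_le
  proof
    fix c :: real
    let ?D = "{x :: nat \<Rightarrow> real^'d. Theta_n x n = {}}"
    let ?T = "\<lambda>x. sample_mean x n + (1 / (1 + c / (2 * real n))) *\<^sub>R (\<theta> - sample_mean x n)"
    have T: "continuous_on UNIV ?T" unfolding sample_mean_def
      by (intro continuous_intros continuous_on_product_coordinates)
    have "{x. - 2 * ln (EL_R x n q) \<le> c} \<in> sets borel" using R by measurable
    \<comment> \<open>For negative \<open>c\<close> the nondegenerate part is empty, as
      \<open>EL_lstar\<close> is nonnegative there.\<close>
    moreover have "(if 0 \<le> c then {x. EL_feasible x n (?T x) (exp (- c / 2))} else {}) \<in> sets borel"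
      using feas[OF T] by simp
    ultimately have "(?D \<inter> {x. - 2 * ln (EL_R x n q) \<le> c}) \<union>
       ((- ?D) \<inter> (if 0 \<le> c then {x. EL_feasible x n (?T x) (exp (- c / 2))} else {})) \<in> sets borel"
      using deg by auto
    also have "(?D \<inter> {x. - 2 * ln (EL_R x n q) \<le> c}) \<union>
       ((- ?D) \<inter> (if 0 \<le> c then {x. EL_feasible x n (?T x) (exp (- c / 2))} else {})) = 
       {x. EL_lstar x n \<theta> \<le> c}"
    proof (rule set_eqI)
      fix x :: "nat \<Rightarrow> real^'d"
      show "x \<in> (?D \<inter> {x. - 2 * ln (EL_R x n q) \<le> c}) \<union>
       ((- ?D) \<inter> (if 0 \<le> c then {x. EL_feasible x n (?T x) (exp (- c / 2))} else {})) \<longleftrightarrow>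
       x \<in> {x. EL_lstar x n \<theta> \<le> c}"
      proof (cases "Theta_n x n = {}")
        case True
        then show ?thesis by (simp add: EL_lstar_def EL_l_def qeq)
      next
        case False
        then show ?thesis
          using EL_lstar_le_iff[OF False, of c \<theta>] EL_lstar_nonneg[OF False, of \<theta>] by auto
      qed
    qed
    finally show "{w \<in> space borel. EL_lstar w n \<theta> \<le> c} \<in> sets borel" by simp
  qed
  from measurable_compose[OF Xm this] show ?thesis .
qed

section \<open>Quadratic approximation\<close>

text \<open>The difference of the two sides has derivative
  \<open>y * ((1 + k) - 1 / (1 + y))\<close>, which has the sign of \<open>y\<close> as long as
  \<open>(1 + k) * (1 + y)\<close> is at least \<open>1\<close>. On the given range this follows
  from \<open>(1 + k) * (1 - k / 2) = 1 + k * (1 - k) / 2\<close>.\<close>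

lemma ln_one_plus_quadratic_lower:
  assumes k: "0 < k" "k \<le> (1::real)" and x: "\<bar>x\<bar> \<le> k / 2"
  shows "x - (1 + k) / 2 * x\<^sup>2 \<le> ln (1 + x)"
proof -
  define f where "f x = ln (1 + x) - x + (1 + k) / 2 * x\<^sup>2" for x :: real
  have d: "(f has_real_derivative y * ((1 + k) - 1 / (1 + y))) (at y)" if "\<bar>y\<bar> \<le> k / 2" for y
  proof -
    have y: "1 + y > 0" using that k by linarith
    then show ?thesis unfolding f_def
      by (auto intro!: derivative_eq_intros simp: field_simps)
  qed
  have g: "0 \<le> (1 + k) - 1 / (1 + y)" if "\<bar>y\<bar> \<le> k / 2" for y
  proof -
    have y: "1 + y > 0" using that k by linarith
    have "(1 + k) * (1 - k / 2) \<le> (1 + k) * (1 + y)" using that k by (intro mult_left_mono) auto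
    moreover have "k * k \<le> k * 1" using k by (intro mult_left_mono) auto
    then have "1 \<le> (1 + k) * (1 - k / 2)" by (simp add: field_simps)
    ultimately have "1 \<le> (1 + k) * (1 + y)" by (rule order_trans[rotated])
    then show ?thesis using y by (simp add: field_simps)
  qed
  have f0: "f 0 = 0" by (simp add: f_def)
  have "0 \<le> f x"
  proof (cases "0 \<le> x")
    case True
    have "f 0 \<le> f x"
    proof (rule DERIV_nonneg_imp_nondecreasing[OF True])
      fix y assume "0 \<le> y" "y \<le> x"
      then have "\<bar>y\<bar> \<le> k / 2" using x by auto
      then show "\<exists>z. (f has_real_derivative z) (at y) \<and> 0 \<le> z"
        using \<open>0 \<le> y\<close> by (intro exI[of _ "y * ((1 + k) - 1 / (1 + y))"] conjI d mult_nonneg_nonneg g)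
    qed
    then show ?thesis using f0 by simp
  next
    case False
    have "f 0 \<le> f x"
    proof (rule DERIV_nonpos_imp_nonincreasing[of x 0 f])
      show "x \<le> 0" using False by simp
      fix y assume "x \<le> y" "y \<le> 0"
      then have "\<bar>y\<bar> \<le> k / 2" using x by auto
      then show "\<exists>z. (f has_real_derivative z) (at y) \<and> z \<le> 0"
        using \<open>y \<le> 0\<close> by (intro exI[of _ "y * ((1 + k) - 1 / (1 + y))"] conjI d mult_nonpos_nonneg g)
    qed
    then show ?thesis using f0 by simp
  qed
  then show ?thesis by (simp add: f_def)
qed

text \<open>Dual bound: every \<open>p\<close> with \<open>1 + p \<bullet> u i > 0\<close> bounds the likelihood ratio from above, because
  \<open>ln t \<le> t - 1\<close>; here \<open>p = m\<close>, which is the optimal multiplier to leading order.\<close>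

lemma EL_feasible_upper:
  fixes u :: "nat \<Rightarrow> real^'d"
  assumes n: "0 < n" and u0: "(\<Sum>i<n. u i) = 0"
    and k: "0 < k" "k \<le> 1/2"
    and cov: "(\<Sum>i<n. (m \<bullet> u i)\<^sup>2) \<le> real n * ((1 + k) * (norm m)\<^sup>2)"
    and small: "\<And>i. i < n \<Longrightarrow> norm m * norm (u i) \<le> k / 2"
    and f: "EL_feasible (\<lambda>i. u i + m) n 0 (exp (- c / 2))"
  shows "real n * (norm m)\<^sup>2 * (2 - (1 + k)\<^sup>2) \<le> c"
proof -
  obtain w where w: "\<And>i. i < n \<Longrightarrow> 0 \<le> w i" "(\<Sum>i<n. w i) = 1" 
    "(\<Sum>i<n. w i *\<^sub>R (u i + m)) = 0" "exp (- c / 2) \<le> (\<Prod>i<n. real n * w i)"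
    using f unfolding EL_feasible_iff by auto
  have mu: "\<bar>m \<bullet> u i\<bar> \<le> k / 2" if "i < n" for i
    using Cauchy_Schwarz_ineq2[of m "u i"] small[OF that] by linarith
  have wpos: "0 < w i" if "i < n" for i
  proof -
    have "(\<Prod>i<n. real n * w i) \<noteq> 0" using w(4) exp_gt_zero[of "- c / 2"] by linarith
    then have "w i \<noteq> 0" using that by auto
    then show ?thesis using w(1)[OF that] by simp
  qed
  \<comment> \<open>By the mean constraint this is the total of
    \<open>w i * (1 + m \<bullet> u i)\<close>. Dividing by it before applying
    \<open>ln t \<le> t - 1\<close> makes the first-order terms sum to \<open>0\<close>, and
    \<open>ln D\<close> contributes the main term
    \<open>- real n * (norm m)\<^sup>2\<close>.\<close>
  define D where "D = 1 - (norm m)\<^sup>2"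
  have "(\<Sum>i<n. w i * (m \<bullet> u i)) + (norm m)\<^sup>2 = m \<bullet> (\<Sum>i<n. w i *\<^sub>R (u i + m))"
    using w(2) by (simp add: inner_sum_right inner_add_right distrib_left sum.distrib power2_norm_eq_inner flip: sum_distrib_right)
  then have wm: "(\<Sum>i<n. w i * (1 + m \<bullet> u i)) = D"
    using w(2,3) by (simp add: distrib_left sum.distrib D_def)
  have p: "1 + m \<bullet> u i > 0" if "i < n" for i using mu[OF that] k by linarith
  have D: "D > 0" unfolding wm[symmetric]
    using wpos p n by (intro sum_pos mult_pos_pos) auto
  have "- c / 2 \<le> (\<Sum>i<n. ln (real n * w i))"
    using w(4) wpos n by (subst (asm) exp_le_prod_iff) auto
  also have "\<dots> = (\<Sum>i<n. ln (real n * w i * (1 + m \<bullet> u i) / D) - ln (1 + m \<bullet> u i) + ln D)"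
  proof (rule sum.cong[OF refl])
    fix i assume "i \<in> {..<n}"
    then have i: "i < n" by simp
    show "ln (real n * w i) = ln (real n * w i * (1 + m \<bullet> u i) / D) - ln (1 + m \<bullet> u i) + ln D"
      using wpos[OF i] p[OF i] D n by (simp add: ln_div ln_mult)
  qed
  also have "\<dots> \<le> (\<Sum>i<n. (real n * w i * (1 + m \<bullet> u i) / D - 1) - (m \<bullet> u i - (1 + k) / 2 * (m \<bullet> u i)\<^sup>2) + (D - 1))"
  proof (rule sum_mono)
    fix i assume "i \<in> {..<n}"
    then have i: "i < n" by simp
    have "ln (real n * w i * (1 + m \<bullet> u i) / D) \<le> real n * w i * (1 + m \<bullet> u i) / D - 1"
      using wpos[OF i] p[OF i] D n by (intro ln_le_minus_one) auto
    moreover have "ln D \<le> D - 1" using D by (rule ln_le_minus_one)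
    moreover have "m \<bullet> u i - (1 + k) / 2 * (m \<bullet> u i)\<^sup>2 \<le> ln (1 + m \<bullet> u i)"
      using k mu[OF i] by (intro ln_one_plus_quadratic_lower) auto
    ultimately show "ln (real n * w i * (1 + m \<bullet> u i) / D) - ln (1 + m \<bullet> u i) + ln D \<le>
      (real n * w i * (1 + m \<bullet> u i) / D - 1) - (m \<bullet> u i - (1 + k) / 2 * (m \<bullet> u i)\<^sup>2) + (D - 1)" by linarith
  qed
  also have "\<dots> = (real n / D * (\<Sum>i<n. w i * (1 + m \<bullet> u i)) - real n) - m \<bullet> (\<Sum>i<n. u i)
      + (1 + k) / 2 * (\<Sum>i<n. (m \<bullet> u i)\<^sup>2) + real n * (D - 1)"
    by (simp add: sum.distrib sum_subtractf sum_distrib_left inner_sum_right mult.assoc)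
      (simp add: right_diff_distrib)
  also have "\<dots> = (1 + k) / 2 * (\<Sum>i<n. (m \<bullet> u i)\<^sup>2) - real n * (norm m)\<^sup>2"
    using D by (simp add: wm u0) (simp add: D_def)
  also have "\<dots> \<le> (1 + k) / 2 * (real n * ((1 + k) * (norm m)\<^sup>2)) - real n * (norm m)\<^sup>2"
    using cov k by (intro diff_right_mono mult_left_mono) auto
  also have "\<dots> = - (real n * (norm m)\<^sup>2 * (2 - (1 + k)\<^sup>2)) / 2"
    by (simp add: power2_eq_square field_simps)
  finally show ?thesis by simp
qed

text \<open>The weights \<open>(1 - a \<bullet> u i) / n\<close>, with \<open>a\<close> solving the linear system given by the sample covariance,
  maximise the quadratic approximation of the log-likelihood.\<close>

lemma EL_feasible_lower:
  fixes u :: "nat \<Rightarrow> real^'d"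
  assumes n: "0 < n" and u0: "(\<Sum>i<n. u i) = 0"
    and k: "0 < k" "k \<le> 1/2"
    and cov: "\<And>a. real n * ((1 - k) * (norm a)\<^sup>2) \<le> (\<Sum>i<n. (a \<bullet> u i)\<^sup>2)"
    and small: "\<And>i. i < n \<Longrightarrow> norm m * norm (u i) \<le> k / 4"
    and c: "real n * (norm m)\<^sup>2 * ((1 + k) / (1 - k)) \<le> c"
  shows "EL_feasible (\<lambda>i. u i + m) n 0 (exp (- c / 2))"
proof -
  \<comment> \<open>The sample covariance operator of the centred sample.\<close>
  define C where "C v = (1 / real n) *\<^sub>R (\<Sum>i<n. (v \<bullet> u i) *\<^sub>R u i)" for v
  have linC: "linear C" unfolding C_def
    by (intro linearI) (simp_all add: inner_add_left scaleR_add_left sum.distrib scaleR_add_right scaleR_sum_right mult.commute)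
  have vC: "real n * (v \<bullet> C v) = (\<Sum>i<n. (v \<bullet> u i)\<^sup>2)" for v
    using n by (simp add: C_def inner_sum_right power2_eq_square)
  have lowC: "(1 - k) * (norm v)\<^sup>2 \<le> v \<bullet> C v" for v
    using cov[of v] n unfolding vC[symmetric] by simp
  have "inj C"
  proof (rule linear_injective_0[OF linC, THEN iffD2], intro allI impI)
    fix v assume "C v = 0"
    then have "(1 - k) * (norm v)\<^sup>2 \<le> 0" using lowC[of v] by simp
    then have "(norm v)\<^sup>2 \<le> 0" using k by (auto simp: mult_le_0_iff)
    then show "v = 0" by simp
  qed
  then have "surj C" by (rule linear_injective_imp_surjective[OF linC _ refl])
  then have "m \<in> range C" by simp
  \<comment> \<open>The weights below give the \<open>u i\<close> the mean \<open>- C a\<close>, so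
    \<open>C a = m\<close> makes the shifted sample balance at \<open>0\<close>.\<close>
  then obtain a where a: "C a = m" by blast
  have na: "(1 - k) * norm a \<le> norm m"
  proof (cases "a = 0")
    case False
    have "(1 - k) * norm a * norm a \<le> norm m * norm a"
      using lowC[of a] Cauchy_Schwarz_ineq2[of a m] unfolding a by (simp add: power2_eq_square ac_simps)
    then show ?thesis using False by simp
  qed simp
  have am: "a \<bullet> m \<le> (norm m)\<^sup>2 / (1 - k)"
  proof -
    have "a \<bullet> m \<le> norm a * norm m" by (rule norm_cauchy_schwarz)
    also have "\<dots> \<le> (norm m / (1 - k)) * norm m"
      using na k by (intro mult_right_mono) (auto simp: field_simps)
    finally show ?thesis by (simp add: power2_eq_square)
  qed
  have au: "\<bar>a \<bullet> u i\<bar> \<le> k / 2" if "i < n" for i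
  proof -
    \<comment> \<open>This factor \<open>2\<close> is why \<open>small\<close> demands
      \<open>k / 4\<close> although the logarithm estimate asks only for
      \<open>k / 2\<close>.\<close>
    have "norm a \<le> 2 * norm m"
    proof -
      have "1 / 2 * norm a \<le> (1 - k) * norm a" using k by (intro mult_right_mono) auto
      then show ?thesis using na by simp
    qed
    then have "norm a * norm (u i) \<le> 2 * norm m * norm (u i)" by (intro mult_right_mono) auto
    then show ?thesis using small[OF that] Cauchy_Schwarz_ineq2[of a "u i"] by simp
  qed
  define w where "w i = (1 - a \<bullet> u i) / real n" for i
  have w0: "0 \<le> w i" "0 < 1 - a \<bullet> u i" if "i < n" for i 
    using au[OF that] k by (auto simp: w_def)
  have w1: "(\<Sum>i<n. w i) = 1"
    using n u0 by (simp add: w_def sum_subtractf diff_divide_distrib flip: sum_divide_distrib inner_sum_right)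
  have "(\<Sum>i<n. w i *\<^sub>R u i) = (1 / real n) *\<^sub>R (\<Sum>i<n. u i) - C a"
    by (simp add: w_def C_def diff_divide_distrib scaleR_diff_left sum_subtractf scaleR_sum_right)
  then have "(\<Sum>i<n. w i *\<^sub>R (u i + m)) = 0"
    using u0 w1 by (simp add: a scaleR_add_right sum.distrib flip: scaleR_sum_left)
  moreover have "exp (- c / 2) \<le> (\<Prod>i<n. 1 - a \<bullet> u i)"
  proof (subst exp_le_prod_iff)
    have "(\<Sum>i<n. (a \<bullet> u i)\<^sup>2) = real n * (a \<bullet> m)" using vC[of a] by (simp add: a)
    also have "\<dots> \<le> real n * ((norm m)\<^sup>2 / (1 - k))" using am by (intro mult_left_mono) auto
    finally have "(1 + k) / 2 * (\<Sum>i<n. (a \<bullet> u i)\<^sup>2) \<le> (1 + k) / 2 * (real n * ((norm m)\<^sup>2 / (1 - k)))"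
      using k by (intro mult_left_mono) auto
    also have "\<dots> = (real n * (norm m)\<^sup>2 * ((1 + k) / (1 - k))) / 2" by (simp add: mult_ac)
    also have "\<dots> \<le> c / 2" by (rule divide_right_mono[OF c]) simp
    finally have "- c / 2 \<le> - (a \<bullet> (\<Sum>i<n. u i)) - (1 + k) / 2 * (\<Sum>i<n. (a \<bullet> u i)\<^sup>2)"
      by (simp add: u0)
    also have "\<dots> = (\<Sum>i<n. (- (a \<bullet> u i)) - (1 + k) / 2 * (- (a \<bullet> u i))\<^sup>2)"
      by (simp add: sum_subtractf sum_negf inner_sum_right sum_distrib_left)
    also have "\<dots> \<le> (\<Sum>i<n. ln (1 - a \<bullet> u i))"
    proof (rule sum_mono)
      fix i assume "i \<in> {..<n}"
      then show "(- (a \<bullet> u i)) - (1 + k) / 2 * (- (a \<bullet> u i))\<^sup>2 \<le> ln (1 - a \<bullet> u i)"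
        using ln_one_plus_quadratic_lower[of k "- (a \<bullet> u i)"] k au[of i] by simp
    qed
    finally show "- c / 2 \<le> (\<Sum>i<n. ln (1 - a \<bullet> u i))" .
  qed (use w0 in auto)
  moreover have "(\<Prod>i<n. 1 - a \<bullet> u i) = (\<Prod>i<n. real n * w i)"
    using n by (simp add: w_def)
  ultimately show ?thesis
    unfolding EL_feasible_iff using w0 w1 by (intro exI[of _ w]) auto
qed

text \<open>The balance condition is merely mapped by \<open>L\<close>, with the same weights. This
  permits passing to the whitened sample and translating the target point to the origin.\<close>

lemma EL_feasible_affine:
  assumes L: "linear L" "inj L"
  shows "EL_feasible x n \<theta> r \<longleftrightarrow> EL_feasible (\<lambda>i. L (x i) + b) n (L \<theta> + b) r"
proof -
  have "(\<Sum>i<n. w i *\<^sub>R (L (x i) + b - (L \<theta> + b))) = L (\<Sum>i<n. w i *\<^sub>R (x i - \<theta>))" for w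
    using L(1) by (simp add: linear_sum linear_diff linear_scale)
  moreover have "L v = 0 \<longleftrightarrow> v = 0" for v
    using linear_injective_0[OF L(1)] L(2) linear_0[OF L(1)] by auto
  ultimately show ?thesis
    unfolding EL_feasible_def by simp
qed

section \<open>Centred samples and their covariance\<close>

lemma sum_centered:
  assumes "0 < n" shows "(\<Sum>i<n. y i - sample_mean y n) = 0"
  using assms by (simp add: sum_subtractf sample_mean_def sum_constant_scaleR del: sum_constant)

lemma sum_inner_centered_sq:
  assumes "0 < n"
  shows "(\<Sum>i<n. (a \<bullet> (y i - sample_mean y n))\<^sup>2) = (\<Sum>i<n. (a \<bullet> y i)\<^sup>2) - real n * (a \<bullet> sample_mean y n)\<^sup>2"
proof -
  define b where "b = a \<bullet> sample_mean y n"
  have b: "(\<Sum>i<n. a \<bullet> y i) = real n * b"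
    using assms by (simp add: b_def sample_mean_def inner_sum_right)
  have "(\<Sum>i<n. (a \<bullet> (y i - sample_mean y n))\<^sup>2) = (\<Sum>i<n. (a \<bullet> y i)\<^sup>2 - 2 * b * (a \<bullet> y i) + b\<^sup>2)"
    by (rule sum.cong) (auto simp: inner_diff_right b_def power2_eq_square algebra_simps)
  also have "\<dots> = (\<Sum>i<n. (a \<bullet> y i)\<^sup>2) - 2 * b * (real n * b) + real n * b\<^sup>2"
    by (simp add: sum.distrib sum_subtractf b flip: sum_distrib_left)
  finally show ?thesis by (simp add: b_def power2_eq_square)
qed

text \<open>Each of the squared-dimension many terms is bounded by
  \<open>e * (norm a)\<^sup>2\<close>; this crude count is the origin of the squared dimension in
  the later entrywise tolerances.\<close>

lemma quadratic_form_near_identity: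
  fixes S :: "'d::finite \<Rightarrow> 'd \<Rightarrow> real" and a :: "real^'d"
  assumes S: "\<And>j k. \<bar>S j k - (if j = k then 1 else 0)\<bar> \<le> e"
  shows "\<bar>(\<Sum>j\<in>UNIV. \<Sum>k\<in>UNIV. a $ j * a $ k * S j k) - (norm a)\<^sup>2\<bar> \<le> e * (real CARD('d))\<^sup>2 * (norm a)\<^sup>2"
proof -
  have "(norm a)\<^sup>2 = (\<Sum>j\<in>UNIV. \<Sum>k\<in>UNIV. a $ j * a $ k * (if j = k then 1 else 0))"
    by (simp add: power2_norm_eq_inner inner_vec_def if_distrib cong: if_cong)
  then have "(\<Sum>j\<in>UNIV. \<Sum>k\<in>UNIV. a $ j * a $ k * S j k) - (norm a)\<^sup>2 =
      (\<Sum>j\<in>UNIV. \<Sum>k\<in>UNIV. a $ j * a $ k * (S j k - (if j = k then 1 else 0)))"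
    by (simp add: sum_subtractf[symmetric] right_diff_distrib)
  also have "\<bar>\<dots>\<bar> \<le> (\<Sum>j\<in>(UNIV::'d set). \<Sum>k\<in>(UNIV::'d set). (norm a)\<^sup>2 * e)"
  proof (intro order_trans[OF sum_abs] sum_mono)
    fix j k :: 'd
    have "\<bar>a $ j\<bar> * \<bar>a $ k\<bar> \<le> norm a * norm a"
      by (intro mult_mono component_le_norm_cart norm_ge_zero abs_ge_zero)
    then have "\<bar>a $ j\<bar> * \<bar>a $ k\<bar> * \<bar>S j k - (if j = k then 1 else 0)\<bar> \<le> (norm a)\<^sup>2 * e"
      unfolding power2_eq_square by (rule mult_mono[OF _ S]) auto
    then show "\<bar>a $ j * a $ k * (S j k - (if j = k then 1 else 0))\<bar> \<le> (norm a)\<^sup>2 * e"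
      by (simp add: abs_mult)
  qed
  also have "\<dots> = e * (real CARD('d))\<^sup>2 * (norm a)\<^sup>2" by (simp add: power2_eq_square)
  finally show ?thesis .
qed

text \<open>The budget \<open>k\<close> is split in half: one part for the entrywise error of the
  uncentred second moments, one for the squared mean removed by centring.\<close>

lemma cov_bounds:
  fixes y :: "nat \<Rightarrow> real^'d"
  assumes n: "0 < n" and k: "0 < k"
    and S: "\<And>i j. \<bar>(\<Sum>l<n. y l $ i * y l $ j) / real n - (if i = j then 1 else 0)\<bar>
        \<le> k / (2 * (real CARD('d))\<^sup>2)"
    and W: "(norm (sample_mean y n))\<^sup>2 \<le> k / 2"
  shows "real n * ((1 - k) * (norm a)\<^sup>2) \<le> (\<Sum>i<n. (a \<bullet> (y i - sample_mean y n))\<^sup>2)"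
    and "(\<Sum>i<n. (a \<bullet> (y i - sample_mean y n))\<^sup>2) \<le> real n * ((1 + k) * (norm a)\<^sup>2)"
proof -
  have q: "(\<Sum>l<n. (a \<bullet> y l)\<^sup>2) / real n = (\<Sum>i\<in>UNIV. \<Sum>j\<in>UNIV. a $ i * a $ j * ((\<Sum>l<n. y l $ i * y l $ j) / real n))"
  proof -
    have "(\<Sum>l<n. (a \<bullet> y l)\<^sup>2) = (\<Sum>l<n. \<Sum>i\<in>UNIV. \<Sum>j\<in>UNIV. a $ i * a $ j * (y l $ i * y l $ j))"
      by (rule sum.cong) (auto simp: inner_vec_def power2_eq_square sum_product mult_ac)
    also have "\<dots> = (\<Sum>i\<in>UNIV. \<Sum>j\<in>UNIV. a $ i * a $ j * (\<Sum>l<n. (y l $ i * y l $ j)))"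
      by (subst sum.swap, rule sum.cong[OF refl], subst sum.swap) (simp add: sum_distrib_left)
    finally show ?thesis by (simp only: sum_divide_distrib[symmetric] times_divide_eq_right)
  qed
  have "\<bar>(\<Sum>l<n. (a \<bullet> y l)\<^sup>2) / real n - (norm a)\<^sup>2\<bar> \<le> k / (2 * (real CARD('d))\<^sup>2) * (real CARD('d))\<^sup>2 * (norm a)\<^sup>2"
    unfolding q by (rule quadratic_form_near_identity) (rule S)
  then have 1: "\<bar>(\<Sum>l<n. (a \<bullet> y l)\<^sup>2) / real n - (norm a)\<^sup>2\<bar> \<le> k / 2 * (norm a)\<^sup>2" by simp
  have "(a \<bullet> sample_mean y n)\<^sup>2 \<le> (norm a)\<^sup>2 * (norm (sample_mean y n))\<^sup>2"
    using Cauchy_Schwarz_ineq[of a "sample_mean y n"] by (simp add: power2_norm_eq_inner)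
  also have "\<dots> \<le> (norm a)\<^sup>2 * (k / 2)" using W by (intro mult_left_mono) auto
  finally have 2: "(a \<bullet> sample_mean y n)\<^sup>2 \<le> k / 2 * (norm a)\<^sup>2" by (simp add: mult.commute)
  have 3: "0 \<le> (a \<bullet> sample_mean y n)\<^sup>2" by simp
  have 4: "(\<Sum>i<n. (a \<bullet> (y i - sample_mean y n))\<^sup>2) = real n * ((\<Sum>l<n. (a \<bullet> y l)\<^sup>2) / real n - (a \<bullet> sample_mean y n)\<^sup>2)"
    using n by (simp add: sum_inner_centered_sq right_diff_distrib)
  have 5: "0 \<le> k / 2 * (norm a)\<^sup>2" using k by simp
  show "real n * ((1 - k) * (norm a)\<^sup>2) \<le> (\<Sum>i<n. (a \<bullet> (y i - sample_mean y n))\<^sup>2)"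
    unfolding 4 using 1 2 by (intro mult_left_mono) (auto simp: left_diff_distrib abs_real_def split: if_splits)
  show "(\<Sum>i<n. (a \<bullet> (y i - sample_mean y n))\<^sup>2) \<le> real n * ((1 + k) * (norm a)\<^sup>2)"
    unfolding 4
  proof (rule mult_left_mono)
    show "(\<Sum>l<n. (a \<bullet> y l)\<^sup>2) / real n - (a \<bullet> sample_mean y n)\<^sup>2 \<le> (1 + k) * (norm a)\<^sup>2"
      using 1 3 5 unfolding distrib_right by linarith
  qed simp
qed

text \<open>\<open>x\<close> is the original and \<open>y = L (x - \<theta>)\<close> the standardised sample; \<open>k\<close> measures how far the
  sample is from the ideal Gaussian situation.\<close>

lemma EL_lstar_sandwich:
  fixes x y :: "nat \<Rightarrow> real^'d"
  assumes n: "0 < n" and k: "0 < k" "k \<le> 1/2" and c: "0 \<le> c"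
    and L: "linear L" "inj L" and y: "\<And>i. y i = L (x i - \<theta>)"
    and S: "\<And>i j. \<bar>(\<Sum>l<n. y l $ i * y l $ j) / real n - (if i = j then 1 else 0)\<bar>
        \<le> k / (2 * (real CARD('d))\<^sup>2)"
    and W: "(norm (sample_mean y n))\<^sup>2 \<le> k / 8"
    and max: "\<And>i. i < n \<Longrightarrow> norm (sample_mean y n) * norm (y i) \<le> k / 8"
  defines "s \<equiv> 1 / (1 + c / (2 * real n))"
  defines "V \<equiv> s\<^sup>2 * (real n * (norm (sample_mean y n))\<^sup>2)"
  shows "EL_lstar x n \<theta> \<le> c \<Longrightarrow> V * (2 - (1 + k)\<^sup>2) \<le> c"
    and "V * ((1 + k) / (1 - k)) \<le> c \<Longrightarrow> EL_lstar x n \<theta> \<le> c"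
proof -
  define z where "z = sample_mean y n"
  define u where "u i = y i - z" for i
  define m where "m = s *\<^sub>R z"
  have s: "0 < s" "s \<le> 1" using c n by (auto simp: s_def divide_simps intro!: add_pos_nonneg)
  have W2: "(norm (sample_mean y n))\<^sup>2 \<le> k / 2" using W k by simp
  note cov = cov_bounds[OF n k(1) S W2, folded z_def, folded u_def]
  have u0: "(\<Sum>i<n. u i) = 0" using sum_centered[OF n, of y] by (simp add: u_def z_def)
  have small: "norm m * norm (u i) \<le> k / 4" if "i < n" for i
  proof -
    have "norm m * norm (u i) \<le> norm z * (norm (y i) + norm z)"
      unfolding m_def u_def using s by (intro mult_mono norm_triangle_ineq4) (auto simp: mult_le_cancel_right1 mult_left_le_one_le)
    also have "\<dots> \<le> k / 4" using max[OF that] W by (simp add: z_def distrib_left power2_eq_square)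
    finally show ?thesis .
  qed
  have small': "norm m * norm (u i) \<le> k / 2" if "i < n" for i using small[OF that] k by simp
  have V: "V = real n * (norm m)\<^sup>2" by (simp add: V_def m_def z_def power_mult_distrib)
  \<comment> \<open>A flat sample would have zero variance in some direction, against the lower
    covariance bound.\<close>
  have ne: "Theta_n x n \<noteq> {}"
  proof
    assume "Theta_n x n = {}"
    then obtain a where a: "norm a = 1" "\<And>i. i < n \<Longrightarrow> a \<bullet> x i = a \<bullet> x 0"
      unfolding Theta_n_empty_iff[OF n] by auto
    obtain g where g: "linear g" "\<And>v. g (L v) = v" using linear_injective_left_inverse[OF L] by (auto simp: fun_eq_iff)
    \<comment> \<open>The adjoint of a left inverse of \<open>L\<close> carries the normal
      \<open>a\<close> to the whitened coordinates.\<close>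
    define b where "b = adjoint g a"
    have bL: "b \<bullet> L v = a \<bullet> v" for v
      using adjoint_works[OF g(1), of "L v" a] by (simp add: b_def g(2) inner_commute)
    have const: "b \<bullet> y i = b \<bullet> y 0" if "i < n" for i
      using a(2)[OF that] by (simp add: y bL inner_diff_right)
    have "b \<bullet> z = b \<bullet> y 0"
    proof -
      have "b \<bullet> z = (\<Sum>i<n. b \<bullet> y i) / real n" by (simp add: z_def sample_mean_def inner_sum_right)
      also have "(\<Sum>i<n. b \<bullet> y i) = (\<Sum>i<n. b \<bullet> y 0)"
        by (rule sum.cong) (auto intro: const)
      also have "(\<Sum>i<n. b \<bullet> y 0) / real n = b \<bullet> y 0" using n by simp
      finally show ?thesis .
    qed
    then have "b \<bullet> u i = 0" if "i < n" for i
      using const[OF that] by (simp add: u_def inner_diff_right)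
    then have "(\<Sum>i<n. (b \<bullet> u i)\<^sup>2) = 0" by simp
    then have "real n * ((1 - k) * (norm b)\<^sup>2) \<le> 0" using cov(1)[of b] by simp
    then have "b = 0" using n k by (auto simp: mult_le_0_iff)
    then have "a \<bullet> a = 0" using bL[of a] by simp
    with a(1) show False by simp
  qed
  have "EL_lstar x n \<theta> \<le> c \<longleftrightarrow> EL_feasible x n (sample_mean x n + s *\<^sub>R (\<theta> - sample_mean x n)) (exp (- c / 2))"
    unfolding s_def by (rule EL_lstar_le_iff[OF ne c])
  \<comment> \<open>In whitened coordinates the target is \<open>z - s *\<^sub>R z\<close> and the
    sample is \<open>u i + z\<close>. The translation puts the target at \<open>0\<close>, leaving
    the mean \<open>m = s *\<^sub>R z\<close>.\<close>
  also have "\<dots> \<longleftrightarrow> EL_feasible (\<lambda>i. L (x i) + (- L \<theta> - z + m)) n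
      (L (sample_mean x n + s *\<^sub>R (\<theta> - sample_mean x n)) + (- L \<theta> - z + m)) (exp (- c / 2))"
    by (rule EL_feasible_affine[OF L])
  also have "(\<lambda>i. L (x i) + (- L \<theta> - z + m)) = (\<lambda>i. u i + m)"
    by (simp add: u_def y linear_diff[OF L(1)] algebra_simps)
  also have "L (sample_mean x n + s *\<^sub>R (\<theta> - sample_mean x n)) + (- L \<theta> - z + m) = 0"
  proof -
    have "z = L (sample_mean x n) - L \<theta>"
      using n L(1) by (simp add: z_def sample_mean_def y linear_diff linear_scale linear_sum sum_subtractf scaleR_diff_right
            sum_constant_scaleR del: sum_constant)
    then have "L (sample_mean x n) = z + L \<theta>" by simp
    then show ?thesis
      using L(1) by (simp add: m_def linear_add linear_diff linear_scale algebra_simps)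
  qed
  finally have iff: "EL_lstar x n \<theta> \<le> c \<longleftrightarrow> EL_feasible (\<lambda>i. u i + m) n 0 (exp (- c / 2))" .
  show "V * (2 - (1 + k)\<^sup>2) \<le> c" if "EL_lstar x n \<theta> \<le> c"
    unfolding V using that iff by (intro EL_feasible_upper[OF n u0 k cov(2) small']) auto
  show "EL_lstar x n \<theta> \<le> c" if "V * ((1 + k) / (1 - k)) \<le> c"
    unfolding iff using that V by (intro EL_feasible_lower[OF n u0 k cov(1) small]) auto
qed

section \<open>Laplace transforms of chi-square and Gaussian distributions\<close>

lemma chi2_density_measurable [measurable]: "chi2_density k \<in> borel_measurable borel"
  unfolding chi2_density_def by measurable

text \<open>The substitution \<open>t = r * u\<close> with \<open>r = 2 / (1 + 2 * s)\<close> turns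
  the exponent into \<open>- u\<close> and leaves a Gamma integral. The case \<open>s = 0\<close> is
  the total mass.\<close>

lemma nn_integral_chi2_density_exp:
  assumes k: "0 < k" and s: "0 \<le> s"
  shows "(\<integral>\<^sup>+t. ennreal (chi2_density k t) * ennreal (exp (- s * t)) \<partial>lborel)
    = ennreal ((1 / (1 + 2 * s)) powr (real k / 2))"
proof -
  define a where "a = real k / 2"
  have a: "0 < a" using k by (simp add: a_def)
  define q where "q = 1 / (1 + 2 * s)"
  have q: "0 < q" "q * (1 + 2 * s) = 1" using s by (auto simp: q_def)
  define r where "r = 2 * q"
  have r: "0 < r" using q by (simp add: r_def)
  have rs: "r * s + r / 2 = 1" using q(2) by (simp add: r_def algebra_simps)
  define f where "f t = t powr (a - 1) / exp t * indicator {0..} t" for t :: real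
  define B where "B = 2 powr a * Gamma a"
  have B: "0 < B" using a by (simp add: B_def)
  have f0: "0 \<le> f t" for t by (simp add: f_def)
  have [measurable]: "f \<in> borel_measurable borel" unfolding f_def by measurable
  have "((\<lambda>t. t powr (a - 1) / exp t) has_integral Gamma a) {0..}"
    using Gamma_integral_real[OF a] .
  moreover have "f = (\<lambda>t. if t \<in> {0..} then t powr (a - 1) / exp t else 0)"
    by (auto simp: f_def fun_eq_iff)
  ultimately have "(f has_integral Gamma a) UNIV"
    by (simp only: has_integral_restrict_UNIV)
  then have If: "(\<integral>\<^sup>+t. ennreal (f t) \<partial>lborel) = ennreal (Gamma a)"
    by (intro nn_integral_has_integral_lborel) (auto simp: f0)
  have eq: "chi2_density k (r * u) * exp (- s * (r * u)) = r powr (a - 1) / B * f u" if "u \<noteq> 0" for u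
  proof (cases "0 < u")
    case True
    have "- (r * u) / 2 + - s * (r * u) = - (u * (r * s + r / 2))" by (simp add: algebra_simps)
    then have e: "exp (- (r * u) / 2) * exp (- s * (r * u)) = exp (- u)"
      unfolding exp_add[symmetric] rs by simp
    have "chi2_density k (r * u) * exp (- s * (r * u)) =
      (r * u) powr (a - 1) / B * (exp (- (r * u) / 2) * exp (- s * (r * u)))"
      using True r by (simp add: chi2_density_def a_def B_def)
    also have "\<dots> = r powr (a - 1) / B * f u"
      unfolding e using True r by (simp add: powr_mult f_def exp_minus field_simps)
    finally show ?thesis .
  next
    case False
    then have "u < 0" using that by simp
    then have "r * u < 0" using r by (simp add: mult_pos_neg)
    then show ?thesis using \<open>u < 0\<close> by (simp add: chi2_density_def f_def)
  qed
  have cn: "0 \<le> chi2_density k t" for t using a by (auto simp: chi2_density_def a_def[symmetric] intro!: divide_nonneg_nonneg mult_nonneg_nonneg less_imp_le[OF Gamma_real_pos])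
  have "(\<integral>\<^sup>+t. ennreal (chi2_density k t) * ennreal (exp (- s * t)) \<partial>lborel)
     = (\<integral>\<^sup>+t. ennreal (chi2_density k t * exp (- s * t)) \<partial>lborel)"
    by (simp add: ennreal_mult'')
  also have "\<dots> = ennreal r * (\<integral>\<^sup>+u. ennreal (chi2_density k (0 + r * u) * exp (- s * (0 + r * u))) \<partial>lborel)"
    using r nn_integral_real_affine[of "\<lambda>t. ennreal (chi2_density k t * exp (- s * t))" r 0] by simp
  also have "(\<integral>\<^sup>+u. ennreal (chi2_density k (0 + r * u) * exp (- s * (0 + r * u))) \<partial>lborel)
      = (\<integral>\<^sup>+u. ennreal (r powr (a - 1) / B) * ennreal (f u) \<partial>lborel)"
  proof (rule nn_integral_cong_AE)
    have "AE u in lborel. u \<noteq> (0::real)" by (rule AE_lborel_singleton)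
    then show "AE u in lborel. ennreal (chi2_density k (0 + r * u) * exp (- s * (0 + r * u)))
      = ennreal (r powr (a - 1) / B) * ennreal (f u)"
      by eventually_elim (use eq f0 B in \<open>simp add: ennreal_mult[symmetric]\<close>)
  qed
  also have "\<dots> = ennreal (r powr (a - 1) / B) * ennreal (Gamma a)"
    by (subst nn_integral_cmult) (simp_all add: If)
  also have "ennreal r * (ennreal (r powr (a - 1) / B) * ennreal (Gamma a)) = ennreal (r * (r powr (a - 1) / B * Gamma a))"
    using r B Gamma_real_pos[OF a] by (simp add: ennreal_mult[symmetric] less_imp_le)
  also have "r * (r powr (a - 1) / B * Gamma a) = (1 / (1 + 2 * s)) powr a"
  proof -
    have "Gamma a \<noteq> 0" using Gamma_real_pos[OF a] by linarith
    then have "r * (r powr (a - 1) / B * Gamma a) = r powr a / 2 powr a"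
      using r a by (simp add: B_def powr_diff)
    also have "\<dots> = (r / 2) powr a" using r by (simp add: powr_divide)
    also have "r / 2 = q" by (simp add: r_def)
    finally show ?thesis by (simp only: q_def)
  qed
  finally show ?thesis by (simp add: a_def)
qed

lemma real_distribution_chi2:
  assumes "0 < k" shows "real_distribution (chi2_distribution k)"
proof -
  have "emeasure (chi2_distribution k) (space (chi2_distribution k)) = 1"
    using nn_integral_chi2_density_exp[OF assms, of 0]
    by (simp add: chi2_distribution_def emeasure_density)
  then have "prob_space (chi2_distribution k)" by (rule prob_spaceI)
  then show ?thesis
    by (simp add: real_distribution_def real_distribution_axioms_def chi2_distribution_def)
qed

lemma chi2_Laplace:
  assumes "0 < k" "0 \<le> s"
  shows "(\<integral>t. exp (- s * t) \<partial>chi2_distribution k) = (1 / (1 + 2 * s)) powr (real k / 2)"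
proof -
  have "(\<integral>t. exp (- s * t) \<partial>chi2_distribution k) = enn2real (\<integral>\<^sup>+t. ennreal (exp (- s * t)) \<partial>chi2_distribution k)"
    by (rule integral_eq_nn_integral) (auto simp: chi2_distribution_def)
  also have "(\<integral>\<^sup>+t. ennreal (exp (- s * t)) \<partial>chi2_distribution k) = ennreal ((1 / (1 + 2 * s)) powr (real k / 2))"
    unfolding nn_integral_chi2_density_exp[OF assms, symmetric] chi2_distribution_def
    by (rule nn_integral_density) auto
  finally show ?thesis by simp
qed

lemma AE_chi2_pos: "AE t in chi2_distribution k. 0 < t"
  unfolding chi2_distribution_def by (subst AE_density) (auto simp: chi2_density_def)

lemma isCont_cdf_chi2:
  assumes "0 < k" shows "isCont (cdf (chi2_distribution k)) t"
proof -
  interpret real_distribution "chi2_distribution k" by (rule real_distribution_chi2[OF assms])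
  have "emeasure (chi2_distribution k) {t} = (\<integral>\<^sup>+x. ennreal (chi2_density k x) * indicator {t} x \<partial>lborel)"
    unfolding chi2_distribution_def by (rule emeasure_density) auto
  also have "\<dots> = 0"
    by (subst nn_integral_0_iff_AE) (use AE_lborel_singleton[of t] in \<open>auto elim!: eventually_mono\<close>)
  finally show ?thesis by (simp add: isCont_cdf measure_def)
qed

text \<open>\<open>t \<mapsto> exp (- t)\<close> maps the half-line into the unit
  interval, where the moments determine the limit by the Weierstrass approximation theorem.\<close>

lemma Laplace_imp_weak_conv:
  assumes dn: "\<And>n. real_distribution (N n)" and d: "real_distribution N'"
    and posn: "\<And>n. AE t in N n. 0 \<le> t" and pos: "AE t in N'. 0 \<le> t"
    and lim: "\<And>k::nat. (\<lambda>n. \<integral>t. exp (- real k * t) \<partial>N n) \<longlonglongrightarrow> (\<integral>t. exp (- real k * t) \<partial>N')"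
  shows "weak_conv_m N N'"
proof (rule integral_cts_step_conv_imp_weak_conv[OF dn d])
  fix x y :: real assume xy: "x < y"
  \<comment> \<open>Clamping at \<open>d\<close> removes the singularity of \<open>ln\<close> at
    \<open>0\<close>. It changes only arguments with \<open>- ln u\<close> beyond
    \<open>\<bar>y\<bar> + 1\<close>, where \<open>cts_step\<close> is already
    \<open>0\<close>.\<close>
  define d where "d = exp (- (\<bar>y\<bar> + 1))"
  define f where "f u = cts_step x y (- ln (max u d))" for u
  have d0: "0 < d" by (simp add: d_def)
  have cts: "continuous_on UNIV (cts_step x y)"
    using cts_step_uniformly_continuous[OF xy] by (rule uniformly_continuous_imp_continuous)
  have "continuous_on UNIV (\<lambda>u. - ln (max u d))"
    using d0 by (intro continuous_intros) (auto simp: max_def)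
  from continuous_on_compose2[OF cts this] have contf: "continuous_on {0..1} f"
    unfolding f_def by (auto intro: continuous_on_subset)
  have f_exp: "f (exp (- t)) = cts_step x y t" for t
  proof (cases "t \<le> \<bar>y\<bar> + 1")
    case True
    then have "max (exp (- t)) d = exp (- t)" by (simp add: d_def max_def)
    then show ?thesis by (simp add: f_def)
  next
    case False
    then have "max (exp (- t)) d = d" by (simp add: d_def max_def)
    then show ?thesis using xy False by (simp add: f_def d_def cts_step_def)
  qed
  show "(\<lambda>n. integral\<^sup>L (N n) (cts_step x y)) \<longlonglongrightarrow> integral\<^sup>L N' (cts_step x y)"
  proof (rule LIMSEQ_I)
    fix e :: real assume e: "0 < e"
    obtain g where g: "real_polynomial_function g" "\<And>u. u \<in> {0..1} \<Longrightarrow> \<bar>f u - g u\<bar> < e / 4"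
      using Stone_Weierstrass_real_polynomial_function[OF compact_Icc contf, of "e / 4"] e by auto
    \<comment> \<open>A polynomial in \<open>exp (- t)\<close> is a combination of the functions
      \<open>exp (- real i * t)\<close>, whose integrals converge by \<open>lim\<close>.\<close>
    obtain a m where gm: "g = (\<lambda>u. \<Sum>i\<le>m. a i * u ^ i)"
      using real_polynomial_function_imp_sum[OF g(1)] by auto
    have pw: "exp (- t) ^ i = exp (- real i * t)" for t :: real and i
      by (simp add: exp_of_nat_mult[symmetric])
    have int: "integrable Q (\<lambda>t. exp (- real i * t))" if "real_distribution Q" "AE t in Q. 0 \<le> t" for Q and i :: nat
    proof -
      interpret real_distribution Q by fact
      show ?thesis
        using that(2) by (intro integrable_const_bound[of _ 1]) (auto elim!: eventually_mono)
    qed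
    have Ig: "(\<integral>t. g (exp (- t)) \<partial>Q) = (\<Sum>i\<le>m. a i * (\<integral>t. exp (- real i * t) \<partial>Q))"
      and Igi: "integrable Q (\<lambda>t. g (exp (- t)))"
      if "real_distribution Q" "AE t in Q. 0 \<le> t" for Q
      unfolding gm pw using int[OF that] by (simp_all add: Bochner_Integration.integral_sum)
    have close: "\<bar>integral\<^sup>L Q (cts_step x y) - (\<integral>t. g (exp (- t)) \<partial>Q)\<bar> \<le> e / 4"
      if Q: "real_distribution Q" "AE t in Q. 0 \<le> t" for Q
    proof -
      interpret real_distribution Q by fact
      have ics: "integrable Q (cts_step x y)" by (rule integrable_cts_step[OF xy])
      have "\<bar>integral\<^sup>L Q (cts_step x y) - (\<integral>t. g (exp (- t)) \<partial>Q)\<bar> = \<bar>\<integral>t. cts_step x y t - g (exp (- t)) \<partial>Q\<bar>"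
        using ics Igi[OF Q] by simp
      also have "\<dots> \<le> (\<integral>t. \<bar>cts_step x y t - g (exp (- t))\<bar> \<partial>Q)"
        by (rule integral_abs_bound)
      also have "\<dots> \<le> (\<integral>t. e / 4 \<partial>Q)"
      proof (rule integral_mono_AE)
        show "AE t in Q. \<bar>cts_step x y t - g (exp (- t))\<bar> \<le> e / 4"
          using Q(2)
        proof eventually_elim
          case (elim t)
          then show ?case using g(2)[of "exp (- t)"] by (simp add: f_exp)
        qed
      qed (use ics Igi[OF Q] in auto)
      also have "\<dots> = e / 4" using prob_space by simp
      finally show ?thesis .
    qed
    have "(\<lambda>n. \<integral>t. g (exp (- t)) \<partial>N n) \<longlonglongrightarrow> (\<integral>t. g (exp (- t)) \<partial>N')"
      unfolding Ig[OF dn posn] Ig[OF \<open>real_distribution N'\<close> pos] by (intro tendsto_intros lim)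
    then obtain n0 where n0: "\<And>n. n \<ge> n0 \<Longrightarrow> \<bar>(\<integral>t. g (exp (- t)) \<partial>N n) - (\<integral>t. g (exp (- t)) \<partial>N')\<bar> < e / 4"
      using e LIMSEQ_D[of _ _ "e / 4"] by (metis divide_pos_pos real_norm_def zero_less_numeral)
    show "\<exists>no. \<forall>n\<ge>no. norm (integral\<^sup>L (N n) (cts_step x y) - integral\<^sup>L N' (cts_step x y)) < e"
    proof (intro exI allI impI)
      fix n assume "n0 \<le> n"
      then show "norm (integral\<^sup>L (N n) (cts_step x y) - integral\<^sup>L N' (cts_step x y)) < e"
        using n0[of n] close[OF dn posn, of n] close[OF \<open>real_distribution N'\<close> pos] e
        unfolding real_norm_def by linarith
    qed
  qed
qed

section \<open>Gaussian vectors\<close>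

abbreviation std_normal_vec :: "('d::finite \<Rightarrow> real) measure" where
  "std_normal_vec \<equiv> Pi\<^sub>M UNIV (\<lambda>_. std_normal_distribution)"

lemma prob_space_std_normal: "prob_space std_normal_distribution"
  using real_dist_normal_dist by (simp add: real_distribution_def)

text \<open>The integrand is \<open>v\<close> times a centred normal density with variance
  \<open>v\<^sup>2 = 1 / (1 + 2 * s)\<close>.\<close>

lemma std_normal_exp_sq:
  assumes "0 \<le> s"
  shows "(\<integral>z. exp (- s * z\<^sup>2) \<partial>std_normal_distribution) = 1 / sqrt (1 + 2 * s)"
    and "integrable std_normal_distribution (\<lambda>z. exp (- s * z\<^sup>2))"
proof -
  interpret prob_space std_normal_distribution by (rule prob_space_std_normal)
  show "integrable std_normal_distribution (\<lambda>z. exp (- s * z\<^sup>2))"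
    using assms by (intro integrable_const_bound[of _ 1]) auto
  define v where "v = 1 / sqrt (1 + 2 * s)"
  have v: "0 < v" "v\<^sup>2 = 1 / (1 + 2 * s)" using assms by (auto simp: v_def power_divide)
  have "(\<integral>z. exp (- s * z\<^sup>2) \<partial>std_normal_distribution) = (\<integral>z. std_normal_density z * exp (- s * z\<^sup>2) \<partial>lborel)"
    by (subst integral_density) auto
  also have "\<dots> = (\<integral>z. v * normal_density 0 v z \<partial>lborel)"
  proof (rule Bochner_Integration.integral_cong[OF refl])
    fix z :: real
    have "- z\<^sup>2 / 2 + - s * z\<^sup>2 = - z\<^sup>2 / (2 * v\<^sup>2)"
      using assms by (simp add: v(2) field_simps)
    moreover have "1 / sqrt (2 * pi) = v / sqrt (2 * pi * v\<^sup>2)"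
      using v(1) by (simp add: real_sqrt_mult)
    ultimately show "std_normal_density z * exp (- s * z\<^sup>2) = v * normal_density 0 v z"
      by (simp add: normal_density_def exp_add[symmetric] mult.assoc)
  qed
  also have "\<dots> = v" using v by simp
  finally show "(\<integral>z. exp (- s * z\<^sup>2) \<partial>std_normal_distribution) = 1 / sqrt (1 + 2 * s)" by (simp add: v_def)
qed

text \<open>For fixed \<open>y\<close> a Gaussian function of \<open>y\<close> becomes an average of
  characters that are linear in \<open>y\<close> in the exponent. This linearises a squared
  norm.\<close>

lemma std_normal_vec_char:
  fixes y :: "'d::finite \<Rightarrow> real"
  shows "(\<integral>z. iexp (\<Sum>j\<in>UNIV. z j * y j) \<partial>std_normal_vec) = of_real (exp (- (\<Sum>j\<in>UNIV. (y j)\<^sup>2) / 2))"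
proof -
  interpret prob_space std_normal_distribution by (rule prob_space_std_normal)
  interpret product_sigma_finite "\<lambda>_::'d. std_normal_distribution" by unfold_locales
  have "(\<integral>z. iexp (\<Sum>j\<in>UNIV. z j * y j) \<partial>std_normal_vec) = (\<integral>z. (\<Prod>j\<in>UNIV. iexp (y j * z j)) \<partial>std_normal_vec)"
    by (simp add: exp_sum sum_distrib_left mult_ac)
  also have "\<dots> = (\<Prod>j\<in>UNIV. \<integral>x. iexp (y j * x) \<partial>std_normal_distribution)"
    by (rule product_integral_prod) (auto intro!: integrable_const_bound[of _ 1])
  also have "\<dots> = (\<Prod>j\<in>UNIV. char std_normal_distribution (y j))"
    by (simp add: char_def)
  also have "\<dots> = of_real (\<Prod>j\<in>UNIV. exp (- ((y j)\<^sup>2) / 2))"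
    by (simp add: char_std_normal_distribution)
  also have "(\<Prod>j\<in>UNIV. exp (- ((y j)\<^sup>2) / 2)) = exp (- (\<Sum>j\<in>UNIV. (y j)\<^sup>2) / 2)"
    by (simp add: exp_sum[symmetric] sum_negf sum_divide_distrib)
  finally show ?thesis .
qed

lemma std_normal_vec_exp_sq:
  assumes "0 \<le> s"
  shows "(\<integral>z. exp (- s * (\<Sum>j\<in>UNIV. (z j)\<^sup>2)) \<partial>(std_normal_vec :: ('d::finite \<Rightarrow> real) measure))
    = (1 / (1 + 2 * s)) powr (real CARD('d) / 2)"
proof -
  interpret prob_space std_normal_distribution by (rule prob_space_std_normal)
  interpret product_sigma_finite "\<lambda>_::'d. std_normal_distribution" by unfold_locales
  have "(\<integral>z. exp (- s * (\<Sum>j\<in>UNIV. (z j)\<^sup>2)) \<partial>(std_normal_vec :: ('d \<Rightarrow> real) measure)) = 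
     (\<integral>z. (\<Prod>j\<in>UNIV. exp (- s * (z j)\<^sup>2)) \<partial>(std_normal_vec :: ('d \<Rightarrow> real) measure))"
    by (simp add: exp_sum sum_distrib_left flip: sum_negf)
  also have "\<dots> = (\<Prod>j\<in>(UNIV::'d set). \<integral>x. exp (- s * x\<^sup>2) \<partial>std_normal_distribution)"
    by (rule product_integral_prod) (auto simp: std_normal_exp_sq(2)[OF assms, simplified])
  also have "\<dots> = (1 / sqrt (1 + 2 * s)) ^ CARD('d)"
    by (simp only: std_normal_exp_sq(1)[OF assms] prod_constant)
  also have "\<dots> = (sqrt (1 / (1 + 2 * s))) ^ CARD('d)" by (simp add: real_sqrt_divide)
  also have "\<dots> = (sqrt (1 / (1 + 2 * s))) powr real CARD('d)"
    using assms by (simp add: powr_realpow)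
  also have "\<dots> = (1 / (1 + 2 * s)) powr (real CARD('d) / 2)"
    using assms by (simp add: powr_half_sqrt[symmetric] powr_powr)
  finally show ?thesis .
qed

section \<open>Limit theorems for independent identically distributed vectors\<close>

lemma ident_distr_integral:
  fixes h :: "'b::topological_space \<Rightarrow> 'c::{banach, second_countable_topology}"
  assumes "distr M borel X = distr M borel Y" "X \<in> borel_measurable M" "Y \<in> borel_measurable M"
    "h \<in> borel_measurable borel"
  shows "(\<integral>\<omega>. h (X \<omega>) \<partial>M) = (\<integral>\<omega>. h (Y \<omega>) \<partial>M)"
  using assms integral_distr[of X M borel h] integral_distr[of Y M borel h] by simp

lemma ident_distr_integrable:
  fixes h :: "'b::topological_space \<Rightarrow> 'c::{banach, second_countable_topology}"
  assumes "distr M borel X = distr M borel Y" "X \<in> borel_measurable M" "Y \<in> borel_measurable M"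
    "h \<in> borel_measurable borel"
  shows "integrable M (\<lambda>\<omega>. h (X \<omega>)) \<longleftrightarrow> integrable M (\<lambda>\<omega>. h (Y \<omega>))"
  using assms integrable_distr_eq[of X M borel h] integrable_distr_eq[of Y M borel h] by simp

lemma ident_distr_compose:
  assumes "distr M borel X = distr M borel Y" "X \<in> borel_measurable M" "Y \<in> borel_measurable M"
    "h \<in> borel_measurable borel"
  shows "distr M borel (\<lambda>\<omega>. h (X \<omega>)) = distr M borel (\<lambda>\<omega>. h (Y \<omega>))"
  using assms distr_distr[of h borel borel X M] distr_distr[of h borel borel Y M] by (simp add: comp_def)

lemma integrable_inner_mult:
  fixes Z :: "'a \<Rightarrow> real^'d"
  assumes [measurable]: "Z \<in> borel_measurable M" and sq: "integrable M (\<lambda>\<omega>. (norm (Z \<omega>))\<^sup>2)"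
  shows "integrable M (\<lambda>\<omega>. (u \<bullet> Z \<omega>) * (v \<bullet> Z \<omega>))"
proof (rule Bochner_Integration.integrable_bound[of _ "\<lambda>\<omega>. norm u * norm v * (norm (Z \<omega>))\<^sup>2"])
  have "\<bar>u \<bullet> Z \<omega>\<bar> * \<bar>v \<bullet> Z \<omega>\<bar> \<le> (norm u * norm (Z \<omega>)) * (norm v * norm (Z \<omega>))" for \<omega>
    by (intro mult_mono Cauchy_Schwarz_ineq2) auto
  then show "AE \<omega> in M. norm ((u \<bullet> Z \<omega>) * (v \<bullet> Z \<omega>)) \<le> norm (norm u * norm v * (norm (Z \<omega>))\<^sup>2)"
    by (intro AE_I2) (simp add: abs_mult power2_eq_square mult_ac)
qed (use sq in auto)

lemma integrable_component_mult:
  fixes Z :: "'a \<Rightarrow> real^'d"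
  assumes "Z \<in> borel_measurable M" "integrable M (\<lambda>\<omega>. (norm (Z \<omega>))\<^sup>2)"
  shows "integrable M (\<lambda>\<omega>. Z \<omega> $ i * Z \<omega> $ j)"
  using integrable_inner_mult[OF assms, of "axis i 1" "axis j 1"] by (simp add: inner_axis')

lemma (in prob_space) integrable_if_norm_square_integrable:
  fixes Z :: "'a \<Rightarrow> real^'d"
  assumes [measurable]: "Z \<in> borel_measurable M" and sq: "integrable M (\<lambda>\<omega>. (norm (Z \<omega>))\<^sup>2)"
  shows "integrable M Z"
proof (rule Bochner_Integration.integrable_bound[of _ "\<lambda>\<omega>. 1 + (norm (Z \<omega>))\<^sup>2"])
  have "norm (Z \<omega>) \<le> 1 + (norm (Z \<omega>))\<^sup>2" for \<omega>
  proof -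
    have "0 \<le> (norm (Z \<omega>) - 1)\<^sup>2" by (rule zero_le_power2)
    then have "2 * norm (Z \<omega>) \<le> 1 + (norm (Z \<omega>))\<^sup>2" by (simp add: power2_diff)
    with norm_ge_zero[of "Z \<omega>"] show ?thesis by linarith
  qed
  then show "AE \<omega> in M. norm (Z \<omega>) \<le> norm (1 + (norm (Z \<omega>))\<^sup>2)"
    by (intro AE_I2) simp
qed (use sq in auto)

text \<open>At each outcome the indicator vanishes for large \<open>n\<close>, so dominated
  convergence applies. Integrability of \<open>W\<close> thus controls both the truncation error and
  the largest observation.\<close>

lemma tail_expectation_tendsto_0:
  fixes W :: "'a \<Rightarrow> real"
  assumes W: "integrable M W" and "0 < c"
  shows "(\<lambda>n. \<integral>\<omega>. \<bar>W \<omega>\<bar> * indicator {c<..} (\<bar>W \<omega>\<bar> / real n) \<partial>M) \<longlonglongrightarrow> 0"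
proof -
  have [measurable]: "W \<in> borel_measurable M" using W by auto
  have "(\<lambda>n. \<integral>\<omega>. \<bar>W \<omega>\<bar> * indicator {c<..} (\<bar>W \<omega>\<bar> / real n) \<partial>M) \<longlonglongrightarrow> (\<integral>\<omega>. 0 \<partial>M)"
  proof (rule integral_dominated_convergence[where w = "\<lambda>\<omega>. \<bar>W \<omega>\<bar>"])
    show "AE \<omega> in M. (\<lambda>n. \<bar>W \<omega>\<bar> * indicator {c<..} (\<bar>W \<omega>\<bar> / real n)) \<longlonglongrightarrow> 0"
    proof (rule AE_I2)
      fix \<omega>
      have "eventually (\<lambda>n. \<bar>W \<omega>\<bar> / real n < c) sequentially"
        using \<open>0 < c\<close> by (intro order_tendstoD(2)[OF _ \<open>0 < c\<close>] tendsto_divide_0[OF tendsto_const] filterlim_compose[OF filterlim_at_top_imp_at_infinity filterlim_real_sequentially]) (auto simp: filterlim_ident)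
      then show "(\<lambda>n. \<bar>W \<omega>\<bar> * indicator {c<..} (\<bar>W \<omega>\<bar> / real n)) \<longlonglongrightarrow> 0"
        by (intro tendsto_eventually, eventually_elim) (simp add: indicator_def)
    qed
  qed (use W in \<open>auto simp: indicator_def\<close>)
  then show ?thesis by simp
qed

context prob_space
begin

text \<open>No variance is assumed. The variables are cut at a fixed level \<open>K\<close>: the
  bounded part obeys Hoeffding's inequality, and the remainder has mean absolute value
  \<open>G\<close>, small enough for Markov's inequality.\<close>

lemma weak_law_large_numbers:
  fixes W :: "nat \<Rightarrow> 'a \<Rightarrow> real"
  assumes indep: "indep_vars (\<lambda>_. borel) W UNIV"
    and ident: "\<And>i. distr M borel (W i) = distr M borel (W 0)"
    and W: "integrable M (W 0)" and e: "0 < e"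
  shows "(\<lambda>n. prob {\<omega>\<in>space M. e \<le> \<bar>(\<Sum>i<n. W i \<omega>) / real n - expectation (W 0)\<bar>}) \<longlonglongrightarrow> 0"
proof (rule LIMSEQ_I)
  fix r :: real assume r: "0 < r"
  have rv [measurable]: "W i \<in> borel_measurable M" for i
    using indep unfolding indep_vars_def by auto
  \<comment> \<open>The first bound makes Markov's estimate \<open>G / (e / 4)\<close> at most
    \<open>r / 2\<close>; the second limits the shift of the expectation caused by
    truncation.\<close>
  have "eventually (\<lambda>n. (\<integral>\<omega>. \<bar>W 0 \<omega>\<bar> * indicator {1<..} (\<bar>W 0 \<omega>\<bar> / real n) \<partial>M) < min (r * e / 8) (e / 4)) sequentially"
    using r e by (intro order_tendstoD(2)[OF tail_expectation_tendsto_0[OF W]]) auto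
  then obtain n1 where n1: "\<And>n. n \<ge> n1 \<Longrightarrow> (\<integral>\<omega>. \<bar>W 0 \<omega>\<bar> * indicator {1<..} (\<bar>W 0 \<omega>\<bar> / real n) \<partial>M) < min (r * e / 8) (e / 4)"
    unfolding eventually_sequentially by auto
  define K where "K = real (Suc n1)"
  have K: "0 < K" by (simp add: K_def)
  define f where "f x = (if \<bar>x\<bar> \<le> K then x else 0)" for x :: real
  define g where "g x = (if \<bar>x\<bar> \<le> K then 0 else x)" for x :: real
  have [measurable]: "f \<in> borel_measurable borel" "g \<in> borel_measurable borel"
    unfolding f_def g_def by measurable
  have fg: "x = f x + g x" for x by (simp add: f_def g_def)
  have gi: "integrable M (\<lambda>\<omega>. g (W 0 \<omega>))"
    by (rule Bochner_Integration.integrable_bound[OF W]) (auto simp: g_def)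
  have fi: "integrable M (\<lambda>\<omega>. f (W 0 \<omega>))"
    by (rule Bochner_Integration.integrable_bound[OF W]) (auto simp: f_def)
  have gI: "integrable M (\<lambda>\<omega>. g (W i \<omega>))" for i
    using ident_distr_integrable[OF ident rv rv, of g i] gi by auto
  define G where "G = (\<integral>\<omega>. \<bar>g (W 0 \<omega>)\<bar> \<partial>M)"
  have Gi: "(\<integral>\<omega>. \<bar>g (W i \<omega>)\<bar> \<partial>M) = G" for i
    using ident_distr_integral[OF ident rv rv, of "\<lambda>x. \<bar>g x\<bar>" i] by (simp add: G_def)
  have "\<bar>W 0 \<omega>\<bar> * indicator {1<..} (\<bar>W 0 \<omega>\<bar> / real (Suc n1)) = \<bar>g (W 0 \<omega>)\<bar>" for \<omega>
    using K unfolding K_def[symmetric] by (auto simp: g_def indicator_def field_simps)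
  then have G: "G < min (r * e / 8) (e / 4)" using n1[of "Suc n1"] by (simp add: G_def)
  have Eg: "\<bar>expectation (\<lambda>\<omega>. g (W 0 \<omega>))\<bar> \<le> G"
    unfolding G_def by (rule integral_abs_bound)
  have Esplit: "expectation (W 0) = expectation (\<lambda>\<omega>. f (W 0 \<omega>)) + expectation (\<lambda>\<omega>. g (W 0 \<omega>))"
    using Bochner_Integration.integral_add[OF fi gi] by (simp flip: fg)
  have bound: "prob {\<omega>\<in>space M. e \<le> \<bar>(\<Sum>i<n. W i \<omega>) / real n - expectation (W 0)\<bar>}
      \<le> 2 * exp (- 2 * real n * (e / 2)\<^sup>2 / (K - (- K))\<^sup>2) + r / 2" if n: "0 < n" for n
  proof -
    let ?A = "{\<omega>\<in>space M. e / 2 \<le> \<bar>(\<Sum>i<n. f (W i \<omega>)) / real n - expectation (\<lambda>\<omega>. f (W 0 \<omega>))\<bar>}"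
    let ?B = "{\<omega>\<in>space M. e / 4 \<le> (\<Sum>i<n. \<bar>g (W i \<omega>)\<bar>) / real n}"
    \<comment> \<open>The deviation \<open>e\<close> is shared out as \<open>e / 2\<close> for the
      bounded part, \<open>e / 4\<close> for the averaged remainder and \<open>e / 4\<close> for its
      expectation.\<close>
    have sub: "{\<omega>\<in>space M. e \<le> \<bar>(\<Sum>i<n. W i \<omega>) / real n - expectation (W 0)\<bar>} \<subseteq> ?A \<union> ?B"
    proof (rule subsetI, rule ccontr)
      fix \<omega> assume a: "\<omega> \<in> {\<omega>\<in>space M. e \<le> \<bar>(\<Sum>i<n. W i \<omega>) / real n - expectation (W 0)\<bar>}" and b: "\<omega> \<notin> ?A \<union> ?B"
      have "(\<Sum>i<n. W i \<omega>) / real n = (\<Sum>i<n. f (W i \<omega>)) / real n + (\<Sum>i<n. g (W i \<omega>)) / real n"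
        by (simp add: sum.distrib[symmetric] fg[symmetric] add_divide_distrib[symmetric])
      moreover have "\<bar>(\<Sum>i<n. g (W i \<omega>)) / real n\<bar> \<le> (\<Sum>i<n. \<bar>g (W i \<omega>)\<bar>) / real n"
        using sum_abs[of "\<lambda>i. g (W i \<omega>)" "{..<n}"] by (simp add: abs_divide divide_right_mono)
      moreover have "e \<le> \<bar>(\<Sum>i<n. W i \<omega>) / real n - expectation (W 0)\<bar>" using a by simp
      moreover have "\<bar>(\<Sum>i<n. f (W i \<omega>)) / real n - expectation (\<lambda>\<omega>. f (W 0 \<omega>))\<bar> < e / 2"
        "(\<Sum>i<n. \<bar>g (W i \<omega>)\<bar>) / real n < e / 4" using a b by auto
      moreover have "G < e / 4" using G by simp
      ultimately show False using Eg Esplit by linarith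
    qed
    have "prob {\<omega>\<in>space M. e \<le> \<bar>(\<Sum>i<n. W i \<omega>) / real n - expectation (W 0)\<bar>} \<le> prob (?A \<union> ?B)"
      by (rule finite_measure_mono[OF sub]) measurable
    also have "\<dots> \<le> prob ?A + prob ?B" by (rule measure_Un_le) measurable
    also have "prob ?A \<le> 2 * exp (- 2 * real n * (e / 2)\<^sup>2 / (K - (- K))\<^sup>2)"
    proof -
      interpret H: Hoeffding_ineq_iid M "{..<n}" "\<lambda>i \<omega>. f (W i \<omega>)" "\<lambda>\<omega>. f (W 0 \<omega>)" "- K" K "expectation (\<lambda>\<omega>. f (W 0 \<omega>))"
      proof unfold_locales
        show "indep_vars (\<lambda>_. borel) (\<lambda>i \<omega>. f (W i \<omega>)) {..<n}"
          by (rule indep_vars_subset[OF indep_vars_compose2[OF indep]]) auto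
        show "AE x in M. f (W 0 x) \<in> {- K..K}" using K by (auto simp: f_def)
        show "distr M borel (\<lambda>\<omega>. f (W i \<omega>)) = distr M borel (\<lambda>\<omega>. f (W 0 \<omega>))" for i
          by (rule ident_distr_compose[OF ident]) auto
      qed auto
      have "0 \<le> e / 2" "- K < K" "{..<n} \<noteq> {}" using e K n by auto
      from H.Hoeffding_ineq_abs_ge'[OF this] show ?thesis by (simp only: card_lessThan)
    qed
    also have "prob ?B \<le> (\<integral>\<omega>. (\<Sum>i<n. \<bar>g (W i \<omega>)\<bar>) / real n \<partial>M) / (e / 4)"
      using gI e by (intro integral_Markov_inequality_measure[where A = "{}"]) (auto intro!: sum_nonneg divide_nonneg_nonneg)
    also have "(\<integral>\<omega>. (\<Sum>i<n. \<bar>g (W i \<omega>)\<bar>) / real n \<partial>M) = G"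
      using gI n by (simp add: Bochner_Integration.integral_sum Gi)
    also have "G / (e / 4) \<le> r / 2" using G e by (simp add: field_simps)
    finally show ?thesis by simp
  qed
  have "(\<lambda>n. exp (- (2 * (e / 2)\<^sup>2 / (K - (- K))\<^sup>2) * real n)) \<longlonglongrightarrow> 0"
    using e K by (intro filterlim_compose[OF exp_at_bot] filterlim_tendsto_neg_mult_at_bot[OF tendsto_const _ filterlim_real_sequentially])
      (auto intro!: divide_pos_pos)
  then have "eventually (\<lambda>n. exp (- (2 * (e / 2)\<^sup>2 / (K - (- K))\<^sup>2) * real n) < r / 8) sequentially"
    using r by (intro order_tendstoD) auto
  then obtain n2 where n2: "\<And>n. n \<ge> n2 \<Longrightarrow> exp (- (2 * (e / 2)\<^sup>2 / (K - (- K))\<^sup>2) * real n) < r / 8"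
    unfolding eventually_sequentially by auto
  show "\<exists>no. \<forall>n\<ge>no. norm (prob {\<omega>\<in>space M. e \<le> \<bar>(\<Sum>i<n. W i \<omega>) / real n - expectation (W 0)\<bar>} - 0) < r"
  proof (intro exI allI impI)
    fix n assume n: "Suc n2 \<le> n"
    have "prob {\<omega>\<in>space M. e \<le> \<bar>(\<Sum>i<n. W i \<omega>) / real n - expectation (W 0)\<bar>} < r"
      using bound[of n] n2[of n] n r by (simp add: mult_ac)
    then show "norm (prob {\<omega>\<in>space M. e \<le> \<bar>(\<Sum>i<n. W i \<omega>) / real n - expectation (W 0)\<bar>} - 0) < r"
      by simp
  qed
qed

text \<open>A union bound gives \<open>n\<close> equal tail probabilities, and \<open>n\<close> is
  at most \<open>\<bar>W 0 \<omega>\<bar> / c\<close> on the tail event, so a vanishing tail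
  expectation remains. With squared norms for \<open>W\<close>, the largest observation is of
  smaller order than \<open>sqrt n\<close>.\<close>

lemma prob_max_ge_tendsto_0:
  fixes W :: "nat \<Rightarrow> 'a \<Rightarrow> real"
  assumes rv [measurable]: "\<And>i. W i \<in> borel_measurable M"
    and ident: "\<And>i. distr M borel (W i) = distr M borel (W 0)"
    and W: "integrable M (W 0)" and c: "0 < c"
  shows "(\<lambda>n. prob {\<omega>\<in>space M. \<exists>i<n. c * real n < \<bar>W i \<omega>\<bar>}) \<longlonglongrightarrow> 0"
proof (rule tendsto_sandwich[of "\<lambda>_. 0"])
  let ?T = "\<lambda>n. \<integral>\<omega>. \<bar>W 0 \<omega>\<bar> * indicator {c<..} (\<bar>W 0 \<omega>\<bar> / real n) \<partial>M"
  show "(\<lambda>n. ?T n / c) \<longlonglongrightarrow> 0"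
    using tendsto_divide[OF tail_expectation_tendsto_0[OF W c] tendsto_const[of c]] c by simp
  show "eventually (\<lambda>n. prob {\<omega>\<in>space M. \<exists>i<n. c * real n < \<bar>W i \<omega>\<bar>} \<le> ?T n / c) sequentially"
    using eventually_gt_at_top[of 0]
  proof eventually_elim
    case (elim n)
    have "{\<omega>\<in>space M. \<exists>i<n. c * real n < \<bar>W i \<omega>\<bar>} = (\<Union>i\<in>{..<n}. {\<omega>\<in>space M. c * real n < \<bar>W i \<omega>\<bar>})"
      by auto
    also have "prob \<dots> \<le> (\<Sum>i\<in>{..<n}. prob {\<omega>\<in>space M. c * real n < \<bar>W i \<omega>\<bar>})"
      by (rule finite_measure_subadditive_finite) auto
    also have "\<dots> = (\<Sum>i\<in>{..<n}. prob {\<omega>\<in>space M. c * real n < \<bar>W 0 \<omega>\<bar>})"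
    proof (rule sum.cong[OF refl])
      fix i
      have "prob {\<omega>\<in>space M. c * real n < \<bar>W j \<omega>\<bar>} = measure (distr M borel (W j)) {x. c * real n < \<bar>x\<bar>}" for j
        by (subst measure_distr) (auto intro!: arg_cong[of _ _ prob])
      then show "prob {\<omega>\<in>space M. c * real n < \<bar>W i \<omega>\<bar>} = prob {\<omega>\<in>space M. c * real n < \<bar>W 0 \<omega>\<bar>}"
        using ident[of i] by simp
    qed
    also have "\<dots> = (\<integral>\<omega>. real n * indicator {\<omega>\<in>space M. c * real n < \<bar>W 0 \<omega>\<bar>} \<omega> \<partial>M)"
      by simp
    also have "\<dots> \<le> (\<integral>\<omega>. \<bar>W 0 \<omega>\<bar> * indicator {c<..} (\<bar>W 0 \<omega>\<bar> / real n) / c \<partial>M)"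
    proof (rule integral_mono)
      show "integrable M (\<lambda>\<omega>. \<bar>W 0 \<omega>\<bar> * indicator {c<..} (\<bar>W 0 \<omega>\<bar> / real n) / c)"
        by (intro integrable_divide Bochner_Integration.integrable_bound[OF W]) (auto simp: indicator_def)
      show "real n * indicator {\<omega>\<in>space M. c * real n < \<bar>W 0 \<omega>\<bar>} \<omega> \<le> \<bar>W 0 \<omega>\<bar> * indicator {c<..} (\<bar>W 0 \<omega>\<bar> / real n) / c" for \<omega>
        using c elim by (auto simp: indicator_def field_simps)
    qed (auto simp: less_top[symmetric])
    finally show ?case by simp
  qed
qed auto

text \<open>The characteristic function of the normalised sum is integrated against a Gaussian in its
  argument; this turns it into the Laplace transform of the squared norm.\<close>

lemma sum_norm_sq_weak_conv_chi2:
  fixes Y :: "nat \<Rightarrow> 'a \<Rightarrow> real^'d"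
  assumes indep: "indep_vars (\<lambda>_. borel) Y UNIV"
    and ident: "\<And>i. distr M borel (Y i) = distr M borel (Y 0)"
    and sq: "integrable M (\<lambda>\<omega>. (norm (Y 0 \<omega>))\<^sup>2)"
    and mean: "expectation (Y 0) = 0"
    and cov: "\<And>i j. expectation (\<lambda>\<omega>. Y 0 \<omega> $ i * Y 0 \<omega> $ j) = (if i = j then 1 else 0)"
  shows "weak_conv_m (\<lambda>n. distr M borel (\<lambda>\<omega>. (norm ((1 / sqrt (real n)) *\<^sub>R (\<Sum>i<n. Y i \<omega>)))\<^sup>2))
    (chi2_distribution CARD('d))"
proof -
  have rv [measurable]: "Y i \<in> borel_measurable M" for i
    using indep unfolding indep_vars_def by auto
  have Yi: "integrable M (Y 0)"
    using rv sq by (rule integrable_if_norm_square_integrable)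
  have [measurable]: "(\<lambda>\<omega>. Y i \<omega> $ j) \<in> borel_measurable M" for i j
    by (rule measurable_compose[OF rv borel_measurable_continuous_onI]) (intro continuous_intros)
  define V where "V n \<omega> = (1 / sqrt (real n)) *\<^sub>R (\<Sum>i<n. Y i \<omega>)" for n \<omega>
  have Vm [measurable]: "V n \<in> borel_measurable M" for n unfolding V_def by measurable
  have [measurable]: "(\<lambda>\<omega>. V n \<omega> $ j) \<in> borel_measurable M" for n j
    by (rule measurable_compose[OF Vm borel_measurable_continuous_onI]) (intro continuous_intros)
  have char: "(\<lambda>n. \<integral>\<omega>. iexp (t \<bullet> V n \<omega>) \<partial>M) \<longlonglongrightarrow> of_real (exp (- (norm t)\<^sup>2 / 2))" for t :: "real^'d"
  \<comment> \<open>The central limit theorem needs a positive variance, here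
    \<open>(norm t)\<^sup>2\<close>, so \<open>t = 0\<close> is separate.\<close>
  proof (cases "t = 0")
    case True
    then show ?thesis using prob_space by simp
  next
    case False
    let ?X = "\<lambda>i \<omega>. t \<bullet> Y i \<omega>"
    have sqt: "integrable M (\<lambda>\<omega>. (t \<bullet> Y 0 \<omega>)\<^sup>2)"
      using integrable_inner_mult[OF rv sq, of t t] by (simp add: power2_eq_square)
    have mean0: "expectation (?X 0) = 0" using Yi mean by simp
    note ij = integrable_component_mult[OF rv sq]
    have "expectation (\<lambda>\<omega>. (t \<bullet> Y 0 \<omega>)\<^sup>2) = expectation (\<lambda>\<omega>. \<Sum>i\<in>UNIV. \<Sum>j\<in>UNIV. t $ i * t $ j * (Y 0 \<omega> $ i * Y 0 \<omega> $ j))"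
      by (rule Bochner_Integration.integral_cong[OF refl]) (simp add: inner_vec_def power2_eq_square sum_product mult_ac)
    also have "\<dots> = (\<Sum>i\<in>UNIV. \<Sum>j\<in>UNIV. t $ i * t $ j * (if i = j then 1 else 0))"
      using ij by (simp add: Bochner_Integration.integral_sum cov)
    also have "\<dots> = (norm t)\<^sup>2"
      by (simp add: power2_norm_eq_inner inner_vec_def if_distrib cong: if_cong)
    finally have var0: "expectation (\<lambda>\<omega>. (t \<bullet> Y 0 \<omega>)\<^sup>2) = (norm t)\<^sup>2" .
    have means: "expectation (?X i) = 0" for i
      using ident_distr_integral[OF ident rv rv, of "\<lambda>y. t \<bullet> y" i] mean0 by simp
    have "weak_conv_m (\<lambda>n. distr M borel (\<lambda>\<omega>. (\<Sum>i<n. ?X i \<omega>) / sqrt (real n * (norm t)\<^sup>2))) std_normal_distribution"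
    proof (rule central_limit_theorem_zero_mean)
      show "indep_vars (\<lambda>i. borel) ?X UNIV"
        by (rule indep_vars_compose2[OF indep]) auto
      show "expectation (?X n) = 0" for n by (rule means)
      show "0 < norm t" using False by simp
      show "integrable M (\<lambda>\<omega>. (?X n \<omega>)\<^sup>2)" for n
        using ident_distr_integrable[OF ident rv rv, of "\<lambda>y. (t \<bullet> y)\<^sup>2" n] sqt by simp
      show "variance (?X n) = (norm t)\<^sup>2" for n
        using ident_distr_integral[OF ident rv rv, of "\<lambda>y. (t \<bullet> y)\<^sup>2" n] var0 means by simp
      show "distr M borel (?X n) = distr M borel (?X 0)" for n
        by (rule ident_distr_compose[OF ident rv rv]) simp
    qed
    \<comment> \<open>The normalisation divides by the standard deviation \<open>norm t\<close>;
      evaluating at \<open>norm t\<close> restores \<open>t \<bullet> V n \<omega>\<close>.\<close>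
    then have "(\<lambda>n. char (distr M borel (\<lambda>\<omega>. (\<Sum>i<n. ?X i \<omega>) / sqrt (real n * (norm t)\<^sup>2))) (norm t))
       \<longlonglongrightarrow> char std_normal_distribution (norm t)"
      by (intro levy_continuity1 real_distribution_distr real_dist_normal_dist) measurable
    moreover have "char (distr M borel (\<lambda>\<omega>. (\<Sum>i<n. ?X i \<omega>) / sqrt (real n * (norm t)\<^sup>2))) (norm t)
       = (\<integral>\<omega>. iexp (t \<bullet> V n \<omega>) \<partial>M)" for n
    proof -
      have eq: "norm t * ((\<Sum>i<n. ?X i \<omega>) / sqrt (real n * (norm t)\<^sup>2)) = t \<bullet> V n \<omega>" for \<omega>
        using False by (simp add: V_def inner_sum_right real_sqrt_mult)
      have "char (distr M borel (\<lambda>\<omega>. (\<Sum>i<n. ?X i \<omega>) / sqrt (real n * (norm t)\<^sup>2))) (norm t)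
         = (\<integral>\<omega>. iexp (norm t * ((\<Sum>i<n. ?X i \<omega>) / sqrt (real n * (norm t)\<^sup>2))) \<partial>M)"
        unfolding char_def by (rule integral_distr) measurable
      then show ?thesis unfolding eq .
    qed
    ultimately show ?thesis by (simp add: char_std_normal_distribution)
  qed
  have Lap: "(\<lambda>n. \<integral>\<omega>. exp (- s * (norm (V n \<omega>))\<^sup>2) \<partial>M) \<longlonglongrightarrow> (1 / (1 + 2 * s)) powr (real CARD('d) / 2)"
    if s: "0 \<le> s" for s
  proof -
    let ?N = "std_normal_vec :: ('d \<Rightarrow> real) measure"
    interpret S: prob_space std_normal_distribution by (rule prob_space_std_normal)
    interpret N: prob_space ?N by (rule prob_space_PiM) (rule prob_space_std_normal)
    interpret P: pair_prob_space M ?N ..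
    \<comment> \<open>With this scale the Gaussian average of \<open>iexp (T z \<bullet> v)\<close>
      over \<open>z\<close> is \<open>exp (- s * (norm v)\<^sup>2)\<close>.\<close>
    define c where "c = sqrt (2 * s)"
    have c2: "c\<^sup>2 = 2 * s" using s by (simp add: c_def)
    define T where "T z = (\<chi> j. c * z j)" for z :: "'d \<Rightarrow> real"
    have Tin: "T z \<bullet> v = (\<Sum>j\<in>UNIV. z j * (c * v $ j))" for z v
      by (simp add: T_def inner_vec_def mult_ac)
    have Tn: "(norm (T z))\<^sup>2 = 2 * s * (\<Sum>j\<in>UNIV. (z j)\<^sup>2)" for z
      by (simp add: power2_norm_eq_inner T_def inner_vec_def sum_distrib_left c2[symmetric]) (simp add: power2_eq_square mult_ac)
    have [measurable]: "(\<lambda>p. T (snd p) \<bullet> V n (fst p)) \<in> borel_measurable (M \<Otimes>\<^sub>M ?N)" for n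
      unfolding Tin by measurable
    have [measurable]: "(\<lambda>p. T (fst p) \<bullet> V n (snd p)) \<in> borel_measurable (?N \<Otimes>\<^sub>M M)" for n
      unfolding Tin by measurable
    have [measurable]: "(\<lambda>z. T z \<bullet> v) \<in> borel_measurable ?N" for v
      unfolding Tin by measurable
    have "(\<lambda>n. \<integral>z. (\<integral>\<omega>. iexp (T z \<bullet> V n \<omega>) \<partial>M) \<partial>?N) \<longlonglongrightarrow> (\<integral>z. complex_of_real (exp (- (norm (T z))\<^sup>2 / 2)) \<partial>?N)"
    proof (rule integral_dominated_convergence[where w = "\<lambda>_. 1"])
      show "(\<lambda>z. complex_of_real (exp (- (norm (T z))\<^sup>2 / 2))) \<in> borel_measurable ?N"
        unfolding Tn by measurable
      show "(\<lambda>z. \<integral>\<omega>. iexp (T z \<bullet> V n \<omega>) \<partial>M) \<in> borel_measurable ?N" for n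
        by (rule borel_measurable_lebesgue_integral) (unfold split_beta', measurable)
      show "AE z in ?N. (\<lambda>n. \<integral>\<omega>. iexp (T z \<bullet> V n \<omega>) \<partial>M) \<longlonglongrightarrow> complex_of_real (exp (- (norm (T z))\<^sup>2 / 2))"
        by (rule AE_I2) (rule char)
      show "AE z in ?N. norm (\<integral>\<omega>. iexp (T z \<bullet> V n \<omega>) \<partial>M) \<le> 1" for n
      proof (rule AE_I2)
        fix z
        have "norm (\<integral>\<omega>. iexp (T z \<bullet> V n \<omega>) \<partial>M) \<le> (\<integral>\<omega>. norm (iexp (T z \<bullet> V n \<omega>)) \<partial>M)"
          by (rule integral_norm_bound)
        then show "norm (\<integral>\<omega>. iexp (T z \<bullet> V n \<omega>) \<partial>M) \<le> 1" using prob_space by simp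
      qed
    qed simp
    moreover have "(\<integral>z. (\<integral>\<omega>. iexp (T z \<bullet> V n \<omega>) \<partial>M) \<partial>?N) = complex_of_real (\<integral>\<omega>. exp (- s * (norm (V n \<omega>))\<^sup>2) \<partial>M)" for n
    proof -
      have "(\<integral>z. (\<integral>\<omega>. iexp (T z \<bullet> V n \<omega>) \<partial>M) \<partial>?N) = (\<integral>\<omega>. (\<integral>z. iexp (T z \<bullet> V n \<omega>) \<partial>?N) \<partial>M)"
      proof (rule P.Fubini_integral)
        show "integrable (M \<Otimes>\<^sub>M ?N) (\<lambda>(\<omega>, z). iexp (T z \<bullet> V n \<omega>))"
          by (rule P.P.integrable_const_bound[of _ 1]) (auto simp: split_beta')
      qed
      also have "\<dots> = (\<integral>\<omega>. complex_of_real (exp (- s * (norm (V n \<omega>))\<^sup>2)) \<partial>M)"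
      proof (rule Bochner_Integration.integral_cong[OF refl])
        fix \<omega>
        have "(\<Sum>j\<in>UNIV. (c * V n \<omega> $ j)\<^sup>2) = 2 * s * (norm (V n \<omega>))\<^sup>2"
          by (simp add: power_mult_distrib c2 sum_distrib_left[symmetric] power2_norm_eq_inner inner_vec_def power2_eq_square[symmetric])
        then show "(\<integral>z. iexp (T z \<bullet> V n \<omega>) \<partial>?N) = complex_of_real (exp (- s * (norm (V n \<omega>))\<^sup>2))"
          unfolding Tin std_normal_vec_char by simp
      qed
      also have "\<dots> = complex_of_real (\<integral>\<omega>. exp (- s * (norm (V n \<omega>))\<^sup>2) \<partial>M)"
        by (rule integral_complex_of_real)
      finally show ?thesis .
    qed
    moreover have "(\<integral>z. complex_of_real (exp (- (norm (T z))\<^sup>2 / 2)) \<partial>?N) = complex_of_real ((1 / (1 + 2 * s)) powr (real CARD('d) / 2))"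
      unfolding integral_complex_of_real Tn std_normal_vec_exp_sq[OF s, symmetric] by simp
    ultimately show ?thesis by (simp only: tendsto_of_real_iff)
  qed
  have "weak_conv_m (\<lambda>n. distr M borel (\<lambda>\<omega>. (norm (V n \<omega>))\<^sup>2)) (chi2_distribution CARD('d))"
  proof (rule Laplace_imp_weak_conv)
    show "real_distribution (distr M borel (\<lambda>\<omega>. (norm (V n \<omega>))\<^sup>2))" for n
      by (rule real_distribution_distr) measurable
    show "real_distribution (chi2_distribution CARD('d))" by (rule real_distribution_chi2) simp
    show "AE t in distr M borel (\<lambda>\<omega>. (norm (V n \<omega>))\<^sup>2). 0 \<le> t" for n
      by (subst AE_distr_iff) auto
    show "AE t in chi2_distribution CARD('d). 0 \<le> t"
      using AE_chi2_pos by (rule eventually_mono) simp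
    fix k :: nat
    have "(\<integral>t. exp (- real k * t) \<partial>distr M borel (\<lambda>\<omega>. (norm (V n \<omega>))\<^sup>2)) = (\<integral>\<omega>. exp (- real k * (norm (V n \<omega>))\<^sup>2) \<partial>M)" for n
      by (rule integral_distr) measurable
    moreover have "(\<lambda>n. \<integral>\<omega>. exp (- real k * (norm (V n \<omega>))\<^sup>2) \<partial>M)
      \<longlonglongrightarrow> (\<integral>t. exp (- real k * t) \<partial>chi2_distribution CARD('d))"
      unfolding chi2_Laplace[OF zero_less_card_finite of_nat_0_le_iff] by (rule Lap) simp
    ultimately show "(\<lambda>n. \<integral>t. exp (- real k * t) \<partial>distr M borel (\<lambda>\<omega>. (norm (V n \<omega>))\<^sup>2))
      \<longlonglongrightarrow> (\<integral>t. exp (- real k * t) \<partial>chi2_distribution CARD('d))"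
      by (simp only:)
  qed
  then show ?thesis by (simp only: V_def)
qed

end

section \<open>Convergence of the extended log-likelihood ratio\<close>

text \<open>Extension by one vector at a time: fewer than the full number of linear conditions
  \<open>B (b i) v = 0\<close> have a nonzero solution \<open>v\<close>, which is then normalised in
  the form \<open>B\<close>.\<close>

lemma bilinear_orthonormal_basis:
  fixes B :: "real^'d \<Rightarrow> real^'d \<Rightarrow> real"
  assumes lin: "\<And>u. linear (B u)" and sym: "\<And>u v. B u v = B v u"
    and pos: "\<And>v. v \<noteq> 0 \<Longrightarrow> 0 < B v v"
  shows "\<exists>b :: 'd \<Rightarrow> real^'d. \<forall>i j. B (b i) (b j) = (if i = j then 1 else 0)"
proof -
  have "\<exists>b :: 'd \<Rightarrow> real^'d. \<forall>i\<in>S. \<forall>j\<in>S. B (b i) (b j) = (if i = j then 1 else 0)" for S :: "'d set"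
    using finite[of S]
  proof (induction S rule: finite_induct)
    case (insert k S)
    then obtain b :: "'d \<Rightarrow> real^'d" where b: "\<And>i j. i \<in> S \<Longrightarrow> j \<in> S \<Longrightarrow> B (b i) (b j) = (if i = j then 1 else 0)"
      by metis
    \<comment> \<open>The Riesz representative of \<open>B (b i)\<close>, so that Euclidean
      orthogonality to \<open>g i\<close> means \<open>B\<close>-orthogonality to
      \<open>b i\<close>.\<close>
    define g where "g i = adjoint (B (b i)) 1" for i
    have g: "v \<bullet> g i = B (b i) v" for v i
      unfolding g_def by (simp add: adjoint_works[OF lin])
    have "dim (g ` S) \<le> card (g ` S)" by (rule dim_le_card') simp
    also have "\<dots> \<le> card S" by (rule card_image_le) simp
    also have "\<dots> < CARD('d)"
      using insert(2) by (intro psubset_card_mono) auto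
    finally obtain v where v: "v \<noteq> 0" "\<And>y. y \<in> span (g ` S) \<Longrightarrow> orthogonal v y"
      using orthogonal_to_subspace_exists[of "g ` S"] by auto
    have bv: "B (b i) v = 0" if "i \<in> S" for i
      using v(2)[OF span_base, of "g i"] that by (simp add: orthogonal_def g)
    define w where "w = v /\<^sub>R sqrt (B v v)"
    have bw: "B (b i) w = 0" "B w (b i) = 0" if "i \<in> S" for i
      using bv[OF that] sym[of w] by (simp_all add: w_def linear_scale[OF lin])
    have "B w w = inverse (sqrt (B v v)) * (inverse (sqrt (B v v)) * B v v)"
      unfolding w_def linear_scale[OF lin] sym[of "_ *\<^sub>R v" v] by simp
    also have "\<dots> = 1" using pos[OF v(1)] by (simp add: field_simps)
    finally have "B w w = 1" .
    then show ?case
      using b bw insert(2) by (intro exI[of _ "b(k := w)"]) auto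
  qed simp
  from this[of UNIV] show ?thesis by simp
qed

text \<open>\<open>B (b j)\<close> reads off the coefficient of \<open>b j\<close>, so the
  \<open>b i\<close> are independent and hence span. A vector orthogonal to all of them is
  orthogonal to itself.\<close>

lemma orthonormal_basis_inj:
  fixes B :: "real^'d \<Rightarrow> real^'d \<Rightarrow> real" and b :: "'d \<Rightarrow> real^'d"
  assumes lin: "\<And>u. linear (B u)" and b: "\<And>i j. B (b i) (b j) = (if i = j then 1 else 0)"
  shows "linear (\<lambda>x. \<chi> i. b i \<bullet> x)" "inj (\<lambda>x. \<chi> i. b i \<bullet> x)"
proof -
  show L: "linear (\<lambda>x. \<chi> i. b i \<bullet> x)"
    by (intro linearI) (simp_all add: vec_eq_iff inner_add_right)
  define T where "T c = (\<Sum>i\<in>UNIV. c $ i *\<^sub>R b i)" for c :: "real^'d"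
  have linT: "linear T"
    unfolding T_def by (intro linearI) (simp_all add: scaleR_add_left sum.distrib scaleR_sum_right)
  have BT: "B (b j) (T c) = c $ j" for j c
    by (simp add: T_def linear_sum[OF lin] linear_scale[OF lin] b if_distrib cong: if_cong)
  have "inj T"
    unfolding linear_injective_0[OF linT]
  proof (intro allI impI)
    fix c assume "T c = 0"
    then have "c $ j = 0" for j using BT[of j c] linear_0[OF lin] by simp
    then show "c = 0" by (simp add: vec_eq_iff)
  qed
  then have "surj T" by (rule linear_injective_imp_surjective[OF linT _ refl])
  show "inj (\<lambda>x. \<chi> i. b i \<bullet> x)"
    unfolding linear_injective_0[OF L]
  proof (intro allI impI)
    fix x :: "real^'d" assume "(\<chi> i. b i \<bullet> x) = 0"
    then have bx: "b i \<bullet> x = 0" for i by (simp add: vec_eq_iff)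
    have "x \<in> range T" using \<open>surj T\<close> by simp
    then obtain c where "x = T c" by blast
    then have "x \<bullet> x = (\<Sum>i\<in>UNIV. c $ i * (b i \<bullet> x))" by (simp add: T_def inner_sum_left)
    then show "x = 0" by (simp add: bx)
  qed
qed

context prob_space
begin

text \<open>The rows of \<open>L\<close> are orthonormal for the second-moment form of
  \<open>Z\<close>, so the second-moment matrix of \<open>L (Z \<omega>)\<close> is their Gram
  matrix.\<close>

lemma exists_whitening:
  fixes Z :: "'a \<Rightarrow> real^'d"
  assumes [measurable]: "Z \<in> borel_measurable M"
    and sq: "integrable M (\<lambda>\<omega>. (norm (Z \<omega>))\<^sup>2)"
    and nondeg: "\<And>v. v \<noteq> 0 \<Longrightarrow> expectation (\<lambda>\<omega>. (v \<bullet> Z \<omega>)\<^sup>2) \<noteq> 0"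
  shows "\<exists>L :: real^'d \<Rightarrow> real^'d. linear L \<and> inj L \<and>
    (\<forall>i j. expectation (\<lambda>\<omega>. L (Z \<omega>) $ i * L (Z \<omega>) $ j) = (if i = j then 1 else 0))"
proof -
  define B where "B u v = expectation (\<lambda>\<omega>. (u \<bullet> Z \<omega>) * (v \<bullet> Z \<omega>))" for u v
  have int: "integrable M (\<lambda>\<omega>. (u \<bullet> Z \<omega>) * (v \<bullet> Z \<omega>))" for u v
    by (rule integrable_inner_mult[OF assms(1) sq])
  have lin: "linear (B u)" for u
    unfolding B_def by (intro linearI) (simp_all add: inner_add_left distrib_left int mult.left_commute[of _ "_ :: real"])
  have sym: "B u v = B v u" for u v by (simp add: B_def mult.commute)
  have pos: "0 < B v v" if "v \<noteq> 0" for v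
  proof -
    have "0 \<le> B v v" unfolding B_def by (rule Bochner_Integration.integral_nonneg) simp
    then show ?thesis using nondeg[OF that] by (simp add: B_def power2_eq_square less_le)
  qed
  obtain b :: "'d \<Rightarrow> real^'d" where b: "\<And>i j. B (b i) (b j) = (if i = j then 1 else 0)"
    using bilinear_orthonormal_basis[OF lin sym pos] by blast
  show ?thesis
    using orthonormal_basis_inj[OF lin b] b[unfolded B_def]
    by (intro exI[of _ "\<lambda>x. \<chi> i. b i \<bullet> x"]) simp
qed

text \<open>Off the event \<open>bad n\<close>, \<open>T n \<omega> \<le> c\<close> implies
  \<open>W n \<omega> \<le> c * \<alpha> k\<close> and is implied by
  \<open>W n \<omega> \<le> c * \<beta> k\<close>. Both factors tend to \<open>1\<close> with
  \<open>k\<close>.\<close>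

lemma EL_lstar_cdf_tendsto:
  fixes X Y :: "nat \<Rightarrow> 'a \<Rightarrow> real^'d"
  assumes X: "\<And>i. X i \<in> borel_measurable M"
    and L: "linear L" "inj L" and Y: "\<And>i \<omega>. Y i \<omega> = L (X i \<omega> - \<theta>)"
    and indep: "indep_vars (\<lambda>_. borel) Y UNIV"
    and ident: "\<And>i. distr M borel (Y i) = distr M borel (Y 0)"
    and sq: "integrable M (\<lambda>\<omega>. (norm (Y 0 \<omega>))\<^sup>2)"
    and mean: "expectation (Y 0) = 0"
    and cov: "\<And>i j. expectation (\<lambda>\<omega>. Y 0 \<omega> $ i * Y 0 \<omega> $ j) = (if i = j then 1 else 0)"
    and c: "0 \<le> c"
  shows "(\<lambda>n. prob {\<omega>\<in>space M. EL_lstar (\<lambda>i. X i \<omega>) n \<theta> \<le> c}) \<longlonglongrightarrow> cdf (chi2_distribution CARD('d)) c"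
proof (rule LIMSEQ_I)
  fix e :: real assume e: "0 < e"
  define F where "F = cdf (chi2_distribution CARD('d))"
  interpret chi: real_distribution "chi2_distribution CARD('d)" by (rule real_distribution_chi2) simp
  have Fcont: "isCont F t" for t unfolding F_def by (rule isCont_cdf_chi2) simp
  have rv [measurable]: "Y i \<in> borel_measurable M" for i
    using indep unfolding indep_vars_def by auto
  have [measurable]: "(\<lambda>\<omega>. Y i \<omega> $ j) \<in> borel_measurable M" for i j
    by (rule measurable_compose[OF rv borel_measurable_continuous_onI]) (intro continuous_intros)
  define T where "T n \<omega> = EL_lstar (\<lambda>i. X i \<omega>) n \<theta>" for n \<omega>
  define W where "W n \<omega> = (norm ((1 / sqrt (real n)) *\<^sub>R (\<Sum>i<n. Y i \<omega>)))\<^sup>2" for n \<omega>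
  have [measurable]: "W n \<in> borel_measurable M" for n unfolding W_def by measurable
  have Tm [measurable]: "T n \<in> borel_measurable M" if "0 < n" for n
    unfolding T_def by (rule measurable_EL_lstar[OF that X])
  have q: "(\<lambda>n. prob {\<omega>\<in>space M. W n \<omega> \<le> t}) \<longlonglongrightarrow> F t" for t
  proof -
    have "weak_conv_m (\<lambda>n. distr M borel (W n)) (chi2_distribution CARD('d))"
      unfolding W_def by (rule sum_norm_sq_weak_conv_chi2[OF indep ident sq mean cov])
    then have "(\<lambda>n. cdf (distr M borel (W n)) t) \<longlonglongrightarrow> F t"
      using Fcont unfolding weak_conv_m_def weak_conv_def F_def by auto
    moreover have "cdf (distr M borel (W n)) t = prob {\<omega>\<in>space M. W n \<omega> \<le> t}" for n
      unfolding cdf_def by (subst measure_distr) (auto intro!: arg_cong[of _ _ prob])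
    ultimately show ?thesis by simp
  qed
  \<comment> \<open>The factor \<open>1 - k\<close> allows for the squared position
    \<open>(s n)\<^sup>2\<close>, the other one for the dual bound; \<open>\<beta>\<close> inverts
    the factor from the explicit weights.\<close>
  define \<alpha> where "\<alpha> k = 1 / ((1 - k) * (2 - (1 + k)\<^sup>2))" for k :: real
  define \<beta> where "\<beta> k = (1 - k) / (1 + k)" for k :: real
  have "eventually (\<lambda>k. F (c * \<alpha> k) < F c + e / 4) (at_right 0)"
  proof (rule order_tendstoD(2))
    have "isCont (\<lambda>k. c * \<alpha> k) 0" unfolding \<alpha>_def by (intro continuous_intros) auto
    then have "isCont (\<lambda>k. F (c * \<alpha> k)) 0" by (rule isCont_o2) (rule Fcont)
    then show "((\<lambda>k. F (c * \<alpha> k)) \<longlongrightarrow> F c) (at_right 0)"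
      by (auto simp: isCont_def \<alpha>_def intro: tendsto_within_subset)
  qed (use e in simp)
  moreover have "eventually (\<lambda>k. F c - e / 4 < F (c * \<beta> k)) (at_right 0)"
  proof (rule order_tendstoD(1))
    have "isCont (\<lambda>k. c * \<beta> k) 0" unfolding \<beta>_def by (intro continuous_intros) auto
    then have "isCont (\<lambda>k. F (c * \<beta> k)) 0" by (rule isCont_o2) (rule Fcont)
    then show "((\<lambda>k. F (c * \<beta> k)) \<longlongrightarrow> F c) (at_right 0)"
      by (auto simp: isCont_def \<beta>_def intro: tendsto_within_subset)
  qed (use e in simp)
  moreover have "eventually (\<lambda>k::real. 0 < k \<and> k < 1/4) (at_right 0)"
    by (auto simp: eventually_at_right[of 0 1] intro!: exI[of _ "1/4"])
  ultimately have "eventually (\<lambda>k. F (c * \<alpha> k) < F c + e / 4 \<and> F c - e / 4 < F (c * \<beta> k) \<and> 0 < k \<and> k < 1/4) (at_right (0::real))"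
    by eventually_elim simp
  then obtain k where Fa: "F (c * \<alpha> k) < F c + e / 4" and Fb: "F c - e / 4 < F (c * \<beta> k)"
    and k: "0 < k" "k < 1/4"
    using eventually_happens[of _ "at_right (0::real)"] trivial_limit_at_right_real[of "0::real"] by blast
  have "eventually (\<lambda>K. 1 - e / 8 < F K) at_top"
    unfolding F_def by (rule order_tendstoD(1)[OF chi.cdf_lim_at_top_prob]) (use e in simp)
  then have "eventually (\<lambda>K. 1 - e / 8 < F K \<and> 0 < K) at_top"
    using eventually_gt_at_top[of 0] by eventually_elim simp
  then obtain K where FK: "1 - e / 8 < F K" and K: "0 < K"
    using eventually_happens[of _ "at_top :: real filter"] by force
  \<comment> \<open>Chosen so that the bounds \<open>K / real n\<close> on the squared mean and
    \<open>d * real n\<close> on squared observations multiply to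
    \<open>(k / 8)\<^sup>2\<close>.\<close>
  define d where "d = (k / 8)\<^sup>2 / K"
  have d: "0 < d" using k K by (simp add: d_def)
  define h where "h = k / (2 * (real CARD('d))\<^sup>2)"
  have h: "0 < h" using k by (simp add: h_def)
  define B1 where "B1 n = {\<omega>\<in>space M. \<not> W n \<omega> \<le> K}" for n
  define B2 where "B2 n = {\<omega>\<in>space M. \<exists>i<n. d * real n < \<bar>(norm (Y i \<omega>))\<^sup>2\<bar>}" for n
  define B3 where "B3 n i j = {\<omega>\<in>space M. h \<le> \<bar>(\<Sum>l<n. Y l \<omega> $ i * Y l \<omega> $ j) / real n - (if i = j then 1 else 0)\<bar>}" for n i j
  define bad where "bad n = B1 n \<union> B2 n \<union> (\<Union>i. \<Union>j. B3 n i j)" for n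
  have [measurable]: "B1 n \<in> events" "B2 n \<in> events" "B3 n i j \<in> events" for n i j
    unfolding B1_def B2_def B3_def by measurable
  then have badm: "bad n \<in> events" for n
    unfolding bad_def by (intro sets.Un sets.finite_UN finite) auto
  have P1: "(\<lambda>n. prob (B1 n)) \<longlonglongrightarrow> 1 - F K"
  proof -
    have "prob (B1 n) = 1 - prob {\<omega>\<in>space M. W n \<omega> \<le> K}" for n
      unfolding B1_def by (rule prob_neg) measurable
    then show ?thesis by (auto intro!: tendsto_intros q)
  qed
  have P2: "(\<lambda>n. prob (B2 n)) \<longlonglongrightarrow> 0"
    unfolding B2_def
  proof (rule prob_max_ge_tendsto_0)
    show "distr M borel (\<lambda>\<omega>. (norm (Y i \<omega>))\<^sup>2) = distr M borel (\<lambda>\<omega>. (norm (Y 0 \<omega>))\<^sup>2)" for i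
      by (rule ident_distr_compose[OF ident rv rv]) measurable
  qed (use sq d in auto)
  have P3: "(\<lambda>n. prob (B3 n i j)) \<longlonglongrightarrow> 0" for i j
  proof -
    have ij: "(\<lambda>y::real^'d. y $ i * y $ j) \<in> borel_measurable borel"
      by (intro borel_measurable_continuous_onI continuous_intros)
    note int = integrable_component_mult[OF rv sq]
    show ?thesis
      unfolding B3_def cov[symmetric]
      by (rule weak_law_large_numbers[OF indep_vars_compose2[OF indep ij] ident_distr_compose[OF ident rv rv ij] int h])
  qed
  define S where "S n = prob (B1 n) + prob (B2 n) + (\<Sum>i\<in>UNIV. \<Sum>j\<in>UNIV. prob (B3 n i j))" for n
  have "S \<longlonglongrightarrow> (1 - F K) + 0 + (\<Sum>i\<in>(UNIV::'d set). \<Sum>j\<in>(UNIV::'d set). 0)"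
    unfolding S_def by (intro tendsto_intros P1 P2 P3)
  then have evS: "eventually (\<lambda>n. S n < e / 8) sequentially"
    using FK by (intro order_tendstoD(2)) auto
  have bad_le: "prob (bad n) \<le> S n" for n
  proof -
    have "prob (\<Union>i. \<Union>j. B3 n i j) \<le> (\<Sum>i\<in>UNIV. prob (\<Union>j. B3 n i j))"
      by (rule finite_measure_subadditive_finite) auto
    also have "\<dots> \<le> (\<Sum>i\<in>UNIV. \<Sum>j\<in>UNIV. prob (B3 n i j))"
      by (intro sum_mono finite_measure_subadditive_finite) auto
    finally have "prob (\<Union>i. \<Union>j. B3 n i j) \<le> (\<Sum>i\<in>UNIV. \<Sum>j\<in>UNIV. prob (B3 n i j))" .
    moreover have "prob (bad n) \<le> prob (B1 n \<union> B2 n) + prob (\<Union>i. \<Union>j. B3 n i j)"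
      unfolding bad_def by (rule measure_Un_le) auto
    moreover have "prob (B1 n \<union> B2 n) \<le> prob (B1 n) + prob (B2 n)"
      by (rule measure_Un_le) auto
    ultimately show ?thesis by (simp add: S_def)
  qed
  define s where "s n = 1 / (1 + c / (2 * real n))" for n
  have s01: "0 < s n" "s n \<le> 1" if "0 < n" for n
    using c that by (auto simp: s_def divide_simps intro!: add_pos_nonneg)
  have evs: "eventually (\<lambda>n. 1 - k < (s n)\<^sup>2) sequentially"
  proof (rule order_tendstoD(1))
    have "(\<lambda>n. c / 2 / real n) \<longlonglongrightarrow> 0" by (rule lim_const_over_n)
    then have "(\<lambda>n. c / (2 * real n)) \<longlonglongrightarrow> 0" by (simp add: field_simps)
    then have "(\<lambda>n. (1 / (1 + c / (2 * real n)))\<^sup>2) \<longlonglongrightarrow> (1 / (1 + 0))\<^sup>2"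
      by (intro tendsto_intros) auto
    then show "(\<lambda>n. (s n)\<^sup>2) \<longlonglongrightarrow> 1" by (simp add: s_def)
  qed (use k in simp)
  have evK: "eventually (\<lambda>n. K / real n < k / 8) sequentially"
    using k by (intro order_tendstoD(2)[OF lim_const_over_n]) auto
  have eva: "eventually (\<lambda>n. prob {\<omega>\<in>space M. W n \<omega> \<le> c * \<alpha> k} < F c + e / 2) sequentially"
    using Fa e by (intro order_tendstoD(2)[OF q]) auto
  have evb: "eventually (\<lambda>n. F c - e / 2 < prob {\<omega>\<in>space M. W n \<omega> \<le> c * \<beta> k}) sequentially"
    using Fb e by (intro order_tendstoD(1)[OF q]) auto
  have kk: "0 < 2 - (1 + k)\<^sup>2"
  proof -
    have "(1 + k)\<^sup>2 \<le> (5/4)\<^sup>2" using k by (intro power_mono) auto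
    also have "\<dots> < 2" by (simp add: power2_eq_square)
    finally show ?thesis by simp
  qed
  have "eventually (\<lambda>n. \<bar>prob {\<omega>\<in>space M. T n \<omega> \<le> c} - F c\<bar> < e) sequentially"
    using eventually_gt_at_top[of 0] evS evs evK eva evb
  proof eventually_elim
    case (elim n)
    note [measurable] = Tm[OF elim(1)]
    have sand: "T n \<omega> \<le> c \<Longrightarrow> (s n)\<^sup>2 * W n \<omega> * (2 - (1 + k)\<^sup>2) \<le> c"
      "(s n)\<^sup>2 * W n \<omega> * ((1 + k) / (1 - k)) \<le> c \<Longrightarrow> T n \<omega> \<le> c"
      if \<omega>: "\<omega> \<in> space M" "\<omega> \<notin> bad n" for \<omega>
    proof -
      let ?m = "sample_mean (\<lambda>i. Y i \<omega>) n"
      have Wn: "W n \<omega> = real n * (norm ?m)\<^sup>2"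
        using elim(1) by (simp add: W_def sample_mean_def power_divide) (simp add: power2_eq_square)
      have "W n \<omega> \<le> K" using \<omega> by (auto simp: bad_def B1_def)
      then have mK: "(norm ?m)\<^sup>2 \<le> K / real n" using elim(1) by (simp add: Wn field_simps)
      have k': "k \<le> 1/2" using k by simp
      have S: "\<bar>(\<Sum>l<n. Y l \<omega> $ i * Y l \<omega> $ j) / real n - (if i = j then 1 else 0)\<bar>
          \<le> k / (2 * (real CARD('d))\<^sup>2)" for i j
    proof -
        have "\<omega> \<notin> B3 n i j" using \<omega> by (auto simp: bad_def)
        then have "\<not> h \<le> \<bar>(\<Sum>l<n. Y l \<omega> $ i * Y l \<omega> $ j) / real n - (if i = j then 1 else 0)\<bar>"
          using \<omega>(1) unfolding B3_def by blast
        then show ?thesis unfolding h_def by linarith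
      qed
      have mk: "(norm ?m)\<^sup>2 \<le> k / 8" using mK elim(4) by linarith
      have max: "norm ?m * norm (Y i \<omega>) \<le> k / 8" if "i < n" for i
      proof (rule power2_le_imp_le)
        have "\<omega> \<notin> B2 n" using \<omega> by (auto simp: bad_def)
        then have "\<not> d * real n < \<bar>(norm (Y i \<omega>))\<^sup>2\<bar>"
          using \<omega>(1) that unfolding B2_def by blast
        then have "(norm (Y i \<omega>))\<^sup>2 \<le> d * real n" by simp
        then have "(norm ?m)\<^sup>2 * (norm (Y i \<omega>))\<^sup>2 \<le> (K / real n) * (d * real n)"
          using mK K by (intro mult_mono) auto
        also have "\<dots> = (k / 8)\<^sup>2" using elim(1) K by (simp add: d_def)
        finally show "(norm ?m * norm (Y i \<omega>))\<^sup>2 \<le> (k / 8)\<^sup>2" by (simp add: power_mult_distrib)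
      qed (use k in simp)
      note sandwich = EL_lstar_sandwich[where y = "\<lambda>i. Y i \<omega>" and x = "\<lambda>i. X i \<omega>"
          and \<theta> = \<theta> and L = L and c = c and k = k and n = n]
      show "(s n)\<^sup>2 * W n \<omega> * (2 - (1 + k)\<^sup>2) \<le> c" if "T n \<omega> \<le> c"
        unfolding Wn s_def
        by (rule sandwich(1)) (fact elim(1) k(1) k' c L Y S mk max that[unfolded T_def])+
      show "T n \<omega> \<le> c" if "(s n)\<^sup>2 * W n \<omega> * ((1 + k) / (1 - k)) \<le> c"
        unfolding T_def
        by (rule sandwich(2)) (fact elim(1) k(1) k' c L Y S mk max that[unfolded Wn s_def])+
    qed
    have up: "prob {\<omega>\<in>space M. T n \<omega> \<le> c} \<le> prob {\<omega>\<in>space M. W n \<omega> \<le> c * \<alpha> k} + prob (bad n)"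
    proof -
      have "{\<omega>\<in>space M. T n \<omega> \<le> c} \<subseteq> {\<omega>\<in>space M. W n \<omega> \<le> c * \<alpha> k} \<union> bad n"
      proof
        fix \<omega> assume a: "\<omega> \<in> {\<omega>\<in>space M. T n \<omega> \<le> c}"
        have "W n \<omega> \<le> c * \<alpha> k" if "\<omega> \<notin> bad n"
        proof -
          have "(1 - k) * W n \<omega> * (2 - (1 + k)\<^sup>2) \<le> (s n)\<^sup>2 * W n \<omega> * (2 - (1 + k)\<^sup>2)"
            using elim(3) kk by (intro mult_right_mono) (auto simp: W_def)
          also have "\<dots> \<le> c" using sand(1) a that by auto
          finally show ?thesis using k kk by (simp add: \<alpha>_def pos_le_divide_eq mult_ac)
        qed
        with a show "\<omega> \<in> {\<omega>\<in>space M. W n \<omega> \<le> c * \<alpha> k} \<union> bad n" by auto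
      qed
      then have "prob {\<omega>\<in>space M. T n \<omega> \<le> c} \<le> prob ({\<omega>\<in>space M. W n \<omega> \<le> c * \<alpha> k} \<union> bad n)"
        using badm by (intro finite_measure_mono) auto
      also have "\<dots> \<le> prob {\<omega>\<in>space M. W n \<omega> \<le> c * \<alpha> k} + prob (bad n)"
        using badm by (intro measure_Un_le) auto
      finally show ?thesis .
    qed
    have lo: "prob {\<omega>\<in>space M. W n \<omega> \<le> c * \<beta> k} \<le> prob {\<omega>\<in>space M. T n \<omega> \<le> c} + prob (bad n)"
    proof -
      have "{\<omega>\<in>space M. W n \<omega> \<le> c * \<beta> k} \<subseteq> {\<omega>\<in>space M. T n \<omega> \<le> c} \<union> bad n"
      proof
        fix \<omega> assume a: "\<omega> \<in> {\<omega>\<in>space M. W n \<omega> \<le> c * \<beta> k}"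
        have "T n \<omega> \<le> c" if "\<omega> \<notin> bad n"
        proof (rule sand(2))
          have "(s n)\<^sup>2 * W n \<omega> \<le> 1 * W n \<omega>"
            using s01[OF elim(1)] by (intro mult_right_mono) (auto simp: W_def power_le_one)
          also have "\<dots> \<le> c * \<beta> k" using a by simp
          finally have "(s n)\<^sup>2 * W n \<omega> * ((1 + k) / (1 - k)) \<le> c * \<beta> k * ((1 + k) / (1 - k))"
            using k by (intro mult_right_mono) auto
          also have "\<dots> = c" using k by (simp add: \<beta>_def)
          finally show "(s n)\<^sup>2 * W n \<omega> * ((1 + k) / (1 - k)) \<le> c" .
        qed (use a that in auto)
        with a show "\<omega> \<in> {\<omega>\<in>space M. T n \<omega> \<le> c} \<union> bad n" by auto
      qed
      then have "prob {\<omega>\<in>space M. W n \<omega> \<le> c * \<beta> k} \<le> prob ({\<omega>\<in>space M. T n \<omega> \<le> c} \<union> bad n)"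
        using badm by (intro finite_measure_mono) auto
      also have "\<dots> \<le> prob {\<omega>\<in>space M. T n \<omega> \<le> c} + prob (bad n)"
        using badm by (intro measure_Un_le) auto
      finally show ?thesis .
    qed
    show ?case using up lo bad_le[of n] elim e by linarith
  qed
  then show "\<exists>no. \<forall>n\<ge>no. norm (prob {\<omega>\<in>space M. EL_lstar (\<lambda>i. X i \<omega>) n \<theta> \<le> c} - cdf (chi2_distribution CARD('d)) c) < e"
    unfolding eventually_sequentially T_def F_def real_norm_def .
qed

end

theorem theorem2:
  fixes M :: "'a measure"
    and X :: "nat \<Rightarrow> 'a \<Rightarrow> real^'d"
    and \<theta>0 :: "real^'d"
    and \<Sigma>0 :: "real^'d^'d"
  assumes "prob_space M"
    and rv: "\<And>i. X i \<in> borel_measurable M"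
    and indep: "prob_space.indep_vars M (\<lambda>_. borel) X UNIV"
    and ident: "\<And>i. distr M borel (X i) = distr M borel (X 0)"
    and second_moment: "integrable M (\<lambda>\<omega>. (norm (X 0 \<omega>))\<^sup>2)"
    and mean: "\<theta>0 = prob_space.expectation M (X 0)"
    and cov: "\<And>i j. \<Sigma>0 $ i $ j =
       prob_space.expectation M (\<lambda>\<omega>. (X 0 \<omega> $ i - \<theta>0 $ i) * (X 0 \<omega> $ j - \<theta>0 $ j))"
    and full_rank: "rank \<Sigma>0 = CARD('d)"
  shows "weak_conv_m (\<lambda>n. distr M borel (\<lambda>\<omega>. EL_lstar (\<lambda>i. X i \<omega>) n \<theta>0))
           (chi2_distribution CARD('d))"
proof -
  interpret prob_space M by fact
  note [measurable] = rv
  define Z where "Z i \<omega> = X i \<omega> - \<theta>0" for i \<omega>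
  have Zm [measurable]: "Z i \<in> borel_measurable M" for i unfolding Z_def by measurable
  have comp [measurable]: "(\<lambda>\<omega>. Z i \<omega> $ j) \<in> borel_measurable M" for i j
    by (rule measurable_compose[OF Zm borel_measurable_continuous_onI]) (intro continuous_intros)
  have Zsq: "integrable M (\<lambda>\<omega>. (norm (Z 0 \<omega>))\<^sup>2)"
  proof (rule Bochner_Integration.integrable_bound[of _ "\<lambda>\<omega>. 2 * (norm (X 0 \<omega>))\<^sup>2 + 2 * (norm \<theta>0)\<^sup>2"])
    have "(norm (Z 0 \<omega>))\<^sup>2 \<le> 2 * (norm (X 0 \<omega>))\<^sup>2 + 2 * (norm \<theta>0)\<^sup>2" for \<omega>
    proof -
      have "(norm (Z 0 \<omega>))\<^sup>2 \<le> (norm (X 0 \<omega>) + norm \<theta>0)\<^sup>2"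
        unfolding Z_def by (intro power_mono norm_triangle_ineq4) simp
      also have "\<dots> \<le> 2 * (norm (X 0 \<omega>))\<^sup>2 + 2 * (norm \<theta>0)\<^sup>2"
        using zero_le_power2[of "norm (X 0 \<omega>) - norm \<theta>0"] by (simp add: power2_sum power2_diff)
      finally show ?thesis .
    qed
    then show "AE \<omega> in M. norm ((norm (Z 0 \<omega>))\<^sup>2) \<le> norm (2 * (norm (X 0 \<omega>))\<^sup>2 + 2 * (norm \<theta>0)\<^sup>2)"
      by (intro AE_I2) simp
  qed (use second_moment in auto)
  have Xi: "integrable M (X 0)"
    using rv second_moment by (rule integrable_if_norm_square_integrable)
  have Zi: "integrable M (Z 0)" and Z0: "expectation (Z 0) = 0"
    using Xi mean prob_space unfolding Z_def[abs_def] by simp_all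
  note ij = integrable_component_mult[OF Zm Zsq]
  \<comment> \<open>A vanishing second moment means \<open>v \<bullet> Z 0 \<omega> = 0\<close>
    almost surely; then \<open>v\<close> lies in the kernel of the covariance matrix, which full
    rank makes trivial.\<close>
  have nondeg: "expectation (\<lambda>\<omega>. (v \<bullet> Z 0 \<omega>)\<^sup>2) \<noteq> 0" if "v \<noteq> 0" for v
  proof
    assume 0: "expectation (\<lambda>\<omega>. (v \<bullet> Z 0 \<omega>)\<^sup>2) = 0"
    have "integrable M (\<lambda>\<omega>. (v \<bullet> Z 0 \<omega>)\<^sup>2)"
      using integrable_inner_mult[OF Zm Zsq, of v v] by (simp add: power2_eq_square)
    with 0 have AE0: "AE \<omega> in M. v \<bullet> Z 0 \<omega> = 0"
      by (subst (asm) integral_nonneg_eq_0_iff_AE) auto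
    have "(\<Sigma>0 *v v) $ i = 0" for i
    proof -
      have "(\<Sigma>0 *v v) $ i = (\<Sum>j\<in>UNIV. expectation (\<lambda>\<omega>. Z 0 \<omega> $ i * Z 0 \<omega> $ j) * v $ j)"
        by (simp add: matrix_vector_mult_def cov Z_def)
      also have "\<dots> = expectation (\<lambda>\<omega>. \<Sum>j\<in>UNIV. Z 0 \<omega> $ i * Z 0 \<omega> $ j * v $ j)"
        using ij by (simp add: Bochner_Integration.integral_sum)
      also have "\<dots> = expectation (\<lambda>\<omega>. Z 0 \<omega> $ i * (v \<bullet> Z 0 \<omega>))"
        by (simp add: inner_vec_def sum_distrib_left mult_ac)
      also have "\<dots> = expectation (\<lambda>\<omega>. 0)"
        by (rule integral_cong_AE) (use AE0 in \<open>auto elim!: eventually_mono\<close>)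
      finally show ?thesis by simp
    qed
    then have "\<Sigma>0 *v v = \<Sigma>0 *v 0" by (simp add: vec_eq_iff)
    moreover have "inj ((*v) \<Sigma>0)" using full_rank by (simp add: full_rank_injective)
    ultimately have "v = 0" by (rule injD[rotated])
    with that show False ..
  qed
  obtain L :: "real^'d \<Rightarrow> real^'d" where L: "linear L" "inj L"
    and Lcov: "\<And>i j. expectation (\<lambda>\<omega>. L (Z 0 \<omega>) $ i * L (Z 0 \<omega>) $ j) = (if i = j then 1 else 0)"
    using exists_whitening[OF Zm Zsq nondeg] by blast
  have bL: "bounded_linear L" using L(1) by (rule linear_conv_bounded_linear[THEN iffD1])
  define Y where "Y i \<omega> = L (X i \<omega> - \<theta>0)" for i \<omega>
  have Lm: "(\<lambda>x. L (x - \<theta>0)) \<in> borel_measurable borel"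
    by (intro borel_measurable_continuous_onI linear_continuous_on_compose[OF _ L(1)] continuous_intros)
  have lim: "(\<lambda>n. prob {\<omega>\<in>space M. EL_lstar (\<lambda>i. X i \<omega>) n \<theta>0 \<le> c}) \<longlonglongrightarrow> cdf (chi2_distribution CARD('d)) c"
    if "0 \<le> c" for c
  proof (rule EL_lstar_cdf_tendsto[OF rv L Y_def _ _ _ _ _ that])
    show "indep_vars (\<lambda>_. borel) Y UNIV"
      unfolding Y_def[abs_def] by (rule indep_vars_compose2[OF indep Lm])
    show "distr M borel (Y i) = distr M borel (Y 0)" for i
      unfolding Y_def[abs_def] by (rule ident_distr_compose[OF ident rv rv Lm])
    have "integrable M (\<lambda>\<omega>. (onorm L)\<^sup>2 * (norm (Z 0 \<omega>))\<^sup>2)" using Zsq by simp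
    then show "integrable M (\<lambda>\<omega>. (norm (Y 0 \<omega>))\<^sup>2)"
    proof (rule Bochner_Integration.integrable_bound)
      show "(\<lambda>\<omega>. (norm (Y 0 \<omega>))\<^sup>2) \<in> borel_measurable M"
        unfolding Y_def[abs_def] using measurable_compose[OF rv Lm] by measurable
      have "(norm (Y 0 \<omega>))\<^sup>2 \<le> (onorm L)\<^sup>2 * (norm (Z 0 \<omega>))\<^sup>2" for \<omega>
        unfolding Y_def Z_def power_mult_distrib[symmetric]
        by (intro power_mono onorm[OF bL]) simp
      then show "AE \<omega> in M. norm ((norm (Y 0 \<omega>))\<^sup>2) \<le> norm ((onorm L)\<^sup>2 * (norm (Z 0 \<omega>))\<^sup>2)"
        by (intro AE_I2) simp
    qed
    have "expectation (\<lambda>\<omega>. L (Z 0 \<omega>)) = L (expectation (Z 0))"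
      by (rule integral_bounded_linear[OF bL Zi])
    then show "expectation (Y 0) = 0"
      using linear_0[OF L(1)] by (simp add: Y_def[abs_def] Z_def Z0)
    show "expectation (\<lambda>\<omega>. Y 0 \<omega> $ i * Y 0 \<omega> $ j) = (if i = j then 1 else 0)" for i j
      using Lcov[of i j] by (simp add: Y_def Z_def)
  qed
  \<comment> \<open>Measurability was shown for positive \<open>n\<close>, so the passage to
    distribution functions is made eventually in \<open>n\<close>.\<close>
  have cdf_eq: "cdf (distr M borel (\<lambda>\<omega>. EL_lstar (\<lambda>i. X i \<omega>) n \<theta>0)) c = prob {\<omega>\<in>space M. EL_lstar (\<lambda>i. X i \<omega>) n \<theta>0 \<le> c}"
    if "0 < n" for n c
    unfolding cdf_def using measurable_EL_lstar[OF that rv]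
    by (subst measure_distr) (auto intro!: arg_cong[of _ _ prob])
  have ev_eq: "eventually (\<lambda>n. prob {\<omega>\<in>space M. EL_lstar (\<lambda>i. X i \<omega>) n \<theta>0 \<le> c} =
      cdf (distr M borel (\<lambda>\<omega>. EL_lstar (\<lambda>i. X i \<omega>) n \<theta>0)) c) sequentially" for c
    using eventually_gt_at_top[of 0] by eventually_elim (simp add: cdf_eq)
  have nonpos: "cdf (chi2_distribution CARD('d)) c = 0" if "c \<le> 0" for c
  proof -
    have "AE t in chi2_distribution CARD('d). t \<notin> {..c}"
      using AE_chi2_pos by (rule eventually_mono) (use that in auto)
    then show ?thesis
      unfolding cdf_def by (auto simp: measure_def atMost_def chi2_distribution_def AE_iff_measurable[OF _ refl] dest!: AE_E3)
  qed
  have "(\<lambda>n. cdf (distr M borel (\<lambda>\<omega>. EL_lstar (\<lambda>i. X i \<omega>) n \<theta>0)) c) \<longlonglongrightarrow> cdf (chi2_distribution CARD('d)) c" for c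
  proof (cases "0 \<le> c")
    case True
    show ?thesis by (rule Lim_transform_eventually[OF lim[OF True] ev_eq])
  next
    case False
    \<comment> \<open>For negative \<open>c\<close> comparison with the threshold \<open>0\<close>
      suffices, since the chi-square distribution function vanishes there.\<close>
    have "(\<lambda>n. prob {\<omega>\<in>space M. EL_lstar (\<lambda>i. X i \<omega>) n \<theta>0 \<le> c}) \<longlonglongrightarrow> 0"
    proof (rule tendsto_sandwich[of "\<lambda>_. 0"])
      show "(\<lambda>n. prob {\<omega>\<in>space M. EL_lstar (\<lambda>i. X i \<omega>) n \<theta>0 \<le> 0}) \<longlonglongrightarrow> 0"
        using lim[of 0] nonpos[of 0] by simp
      show "eventually (\<lambda>n. prob {\<omega>\<in>space M. EL_lstar (\<lambda>i. X i \<omega>) n \<theta>0 \<le> c} \<le>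
          prob {\<omega>\<in>space M. EL_lstar (\<lambda>i. X i \<omega>) n \<theta>0 \<le> 0}) sequentially"
        using eventually_gt_at_top[of 0]
      proof eventually_elim
        case (elim n)
        show ?case
          using False measurable_EL_lstar[OF elim rv] by (intro finite_measure_mono) auto
      qed
    qed auto
    then have "(\<lambda>n. cdf (distr M borel (\<lambda>\<omega>. EL_lstar (\<lambda>i. X i \<omega>) n \<theta>0)) c) \<longlonglongrightarrow> 0"
      by (rule Lim_transform_eventually[OF _ ev_eq])
    then show ?thesis using nonpos[of c] False by simp
  qed
  then show ?thesis by (simp add: weak_conv_m_def weak_conv_def)
qed

end
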